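(* Let $\Gamma$ be a finitely-generated Abelian group of (orientation-preserving) $C^2$ diffeomorphisms of the circle $\mathrm{S}^1$ that is conjugate to a group of rotations by a $C^1$ diffeomorphism (that is, there is a $C^1$ circle diffeomorphism $\varphi$ such that $\varphi^{-1} f\varphi$ is a rotation for every $f\in\Gamma$). Then there exists a sequence $(h_n)$ of $C^2$ circle diffeomorphisms such that, for all $f\in\Gamma$, the sequence of conjugates $h_n f h_n^{-1}$ converges to a rotation in the $C^2$ topology as $n\to\infty$.
   Context: All diffeomorphisms are orientation preserving; $\mathrm{S}^1=\mathbb{R}/\mathbb{Z}$ and rotations are the maps $x\mapsto x+\rho$. *)

theory Defs
  imports "HOL-Analysis.Analysis" "HOL-Algebra.Bij" "HOL-Algebra.Generated_Groups"
begin

quotient_type circle = real / "\<lambda>x y::real. x - y \<in> \<int>"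
  morphisms rep_circle circle_proj
proof (intro equivpI reflpI sympI transpI)
  fix x y z :: real
  show "x - x \<in> \<int>" by simp
  show "y - x \<in> \<int>" if "x - y \<in> \<int>"
    using Ints_minus[OF that] by simp
  show "x - z \<in> \<int>" if "x - y \<in> \<int>" "y - z \<in> \<int>"
    using Ints_add[OF that] by simp
qed

instantiation circle :: ab_group_add
begin

lift_definition zero_circle :: circle is "0::real" .

lift_definition plus_circle :: "circle \<Rightarrow> circle \<Rightarrow> circle" is "(+) :: real \<Rightarrow> _"
proof -
  fix a b c d :: real
  assume "a - b \<in> \<int>" "c - d \<in> \<int>"
  then have "(a - b) + (c - d) \<in> \<int>" by (rule Ints_add)
  then show "a + c - (b + d) \<in> \<int>" by (simp add: algebra_simps)
qed

lift_definition uminus_circle :: "circle \<Rightarrow> circle" is "uminus :: real \<Rightarrow> _"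
proof -
  fix a b :: real
  assume "a - b \<in> \<int>"
  then have "- (a - b) \<in> \<int>" by (rule Ints_minus)
  then show "- a - - b \<in> \<int>" by simp
qed

lift_definition minus_circle :: "circle \<Rightarrow> circle \<Rightarrow> circle" is "(-) :: real \<Rightarrow> _"
proof -
  fix a b c d :: real
  assume "a - b \<in> \<int>" "c - d \<in> \<int>"
  then have "(a - b) - (c - d) \<in> \<int>" by (rule Ints_diff)
  then show "a - c - (b - d) \<in> \<int>" by (simp add: algebra_simps)
qed

instance
  by standard (transfer; simp add: algebra_simps)+

end

definition rotation :: "circle \<Rightarrow> circle \<Rightarrow> circle" where
  "rotation \<rho> = (\<lambda>x. x + \<rho>)"

definition Ck_real :: "nat \<Rightarrow> (real \<Rightarrow> real) \<Rightarrow> bool" where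
  "Ck_real k F \<longleftrightarrow>
     (\<forall>j<k. \<forall>x. (deriv ^^ j) F differentiable (at x)) \<and> continuous_on UNIV ((deriv ^^ k) F)"

definition is_lift :: "(real \<Rightarrow> real) \<Rightarrow> (circle \<Rightarrow> circle) \<Rightarrow> bool" where
  "is_lift F f \<longleftrightarrow> continuous_on UNIV F \<and> (\<forall>x. circle_proj (F x) = f (circle_proj x))"

(* Continuous lifts of a circle map differ by an integer constant, so regularity, monotonicity
   and derivatives do not depend on the lift chosen below. *)

definition Ck_circle :: "nat \<Rightarrow> (circle \<Rightarrow> circle) \<Rightarrow> bool" where
  "Ck_circle k f \<longleftrightarrow> (\<exists>F. is_lift F f \<and> Ck_real k F)"

definition orientation_preserving :: "(circle \<Rightarrow> circle) \<Rightarrow> bool" where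
  "orientation_preserving f \<longleftrightarrow> (\<exists>F. is_lift F f \<and> strict_mono F)"

(* The HOL inverse is written inv_into UNIV, since the group library claims the prefix inv. *)

definition circle_diffeo :: "nat \<Rightarrow> (circle \<Rightarrow> circle) \<Rightarrow> bool" where
  "circle_diffeo k f \<longleftrightarrow>
     bij f \<and> Ck_circle k f \<and> Ck_circle k (inv_into UNIV f) \<and> orientation_preserving f"

(* C^k topology: uniform convergence on the circle together with the first k derivatives.  A
   uniformly convergent sequence of circle maps has lifts converging uniformly on the whole line
   (choose the lifts F n close to G), and conversely; j = 0 below is this C^0 part. *)

definition Ck_converges ::
  "nat \<Rightarrow> (nat \<Rightarrow> circle \<Rightarrow> circle) \<Rightarrow> (circle \<Rightarrow> circle) \<Rightarrow> bool" where
  "Ck_converges k f g \<longleftrightarrow>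
     (\<exists>F G. (\<forall>n. is_lift (F n) (f n) \<and> Ck_real k (F n)) \<and> is_lift G g \<and> Ck_real k G \<and>
        (\<forall>j\<le>k. uniform_limit UNIV (\<lambda>n. (deriv ^^ j) (F n)) ((deriv ^^ j) G) sequentially))"

end

theory Submission imports Defs "HOL-Real_Asymp.Real_Asymp" begin

text \<open>
  Let \<open>\<Phi>\<close> be a lift of the conjugacy \<open>\<phi>\<close> and \<open>\<Psi>\<close> its inverse, so that every element of the group lifts
  to some \<open>G t x = \<Phi> (\<Psi> x + t)\<close>. In the coordinate \<open>y = \<Psi> x\<close> the logarithm of the derivative of \<open>G t\<close> is
  the coboundary \<open>A t y = ln (\<Phi>' (y + t)) - ln (\<Phi>' y)\<close>, which is bounded uniformly in \<open>t\<close>; and \<open>G t\<close> is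
  \<open>C\<^sup>2\<close> iff \<open>A t\<close> is \<open>C\<^sup>1\<close>. Along a combination of \<open>N\<close> generators the derivative of \<open>A t\<close> is a sum of
  \<open>N\<close> translates of finitely many functions, so it is \<open>N\<close> times an equicontinuous family; as its primitive
  stays bounded, it is \<open>o(N)\<close> uniformly. This replaces unique ergodicity and needs no distinction between
  rational and irrational rotation numbers.

  Take for \<open>H n\<close> the average of the \<open>G t\<close> over the combinations \<open>t\<close> of the generators with coefficients at
  most \<open>n\<close>. For a generator \<open>s\<close> the difference \<open>H n \<circ> G s - H n\<close> telescopes to the two faces of the box:
  it tends to \<open>s\<close>, its first derivative is \<open>O(1/n)\<close> and its second derivative tends to \<open>0\<close>. These
  properties pass to sums and negatives. As the second derivative of \<open>H n\<close> is \<open>o(n)\<close>, the conjugate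
  \<open>H n \<circ> G t \<circ> (H n)\<^sup>-\<^sup>1 = id + (H n \<circ> G t - H n) \<circ> (H n)\<^sup>-\<^sup>1\<close> converges to \<open>id + t\<close> in \<open>C\<^sup>2\<close>.
\<close>

section \<open>Circle maps and their lifts\<close>

lemma circle_proj_eq_iff: "circle_proj x = circle_proj y \<longleftrightarrow> x - y \<in> \<int>"
  by (rule circle.abs_eq_iff)

lemma circle_proj_rep [simp]: "circle_proj (rep_circle c) = c"
  by (rule Quotient3_abs_rep[OF Quotient3_circle])

lemma circle_proj_surj: obtains x where "c = circle_proj x"
  by (metis circle_proj_rep)

lemma circle_proj_add: "circle_proj x + circle_proj y = circle_proj (x + y)"
  by (rule plus_circle.abs_eq)

lemma is_lift_id: "is_lift (\<lambda>x. x) id"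
  by (simp add: is_lift_def)

lemma is_lift_rotation: "is_lift (\<lambda>x. x + t) (rotation (circle_proj t))"
  by (auto simp: is_lift_def rotation_def circle_proj_add intro!: continuous_intros)

lemma is_lift_comp:
  assumes "is_lift F f" "is_lift G g"
  shows "is_lift (F \<circ> G) (f \<circ> g)"
  using assms by (auto simp: is_lift_def intro: continuous_on_compose2)

text \<open>The difference of two lifts is continuous with integer values. Distinct integers are at
  least 1 apart, so it is constant on the connected line.\<close>

lemma is_lift_unique:
  assumes "is_lift F f" "is_lift G f"
  obtains k :: int where "\<And>x. F x = G x + k"
proof -
  have Z: "F x - G x \<in> \<int>" for x
    using assms by (simp add: is_lift_def flip: circle_proj_eq_iff)
  have "(\<lambda>x. F x - G x) constant_on UNIV"
  proof (rule continuous_discrete_range_constant)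
    show "continuous_on UNIV (\<lambda>x. F x - G x)"
      using assms by (auto simp: is_lift_def intro!: continuous_intros)
    show "\<exists>e>0. \<forall>y. y \<in> UNIV \<and> F y - G y \<noteq> F x - G x \<longrightarrow> e \<le> norm (F y - G y - (F x - G x))" for x
      using Ints_nonzero_abs_ge1[OF Ints_diff[OF Z Z]] by (intro exI[of _ 1]) auto
  qed auto
  then obtain c where "\<And>x. F x - G x = c" by (auto simp: constant_on_def)
  moreover from this obtain k where "c = of_int k" by (metis Z Ints_cases)
  ultimately show thesis by (intro that[of k]) (metis add.commute diff_add_cancel)
qed

lemma lift_degree:
  assumes "is_lift F f"
  obtains d :: int where "\<And>x. F (x + 1) = F x + d"
proof -
  have "circle_proj (x + 1) = circle_proj x" for x
    by (simp add: circle_proj_eq_iff)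
  then have "is_lift (\<lambda>x. F (x + 1)) f"
    using assms by (auto simp: is_lift_def intro!: continuous_on_compose2[of UNIV F] continuous_intros)
  from is_lift_unique[OF this assms] show thesis using that by metis
qed

lemma shift_int:
  fixes F :: "real \<Rightarrow> real"
  assumes "\<And>x. F (x + 1) = F x + d"
  shows "F (x + of_int k) = F x + of_int k * d"
proof (induction k rule: int_induct[of _ 0])
  case (step1 i)
  then show ?case using assms[of "x + of_int i"] by (simp add: algebra_simps)
next
  case (step2 i)
  then show ?case using assms[of "x + of_int (i - 1)"] by (simp add: algebra_simps)
qed auto

lemma surj_shift:
  fixes H :: "real \<Rightarrow> real"
  assumes "\<And>x. H (x + 1) = H x + 1" "continuous_on UNIV H"
  shows "surj H"
proof -
  have "\<exists>x. H x = y" for y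
  proof -
    \<comment> \<open>\<open>H\<close> takes the value \<open>H 0 + ?k\<close> at \<open>?k\<close>,
      so the floor brackets \<open>y\<close> between the values at two consecutive integers.\<close>
    let ?k = "\<lfloor>y - H 0\<rfloor>"
    have "H (of_int ?k) \<le> y" "y \<le> H (of_int ?k + 1)"
      using shift_int[of H 1 0 ?k] assms(1) by simp_all linarith+
    then show ?thesis
      using IVT'[of H "of_int ?k" y "of_int ?k + 1"] assms(2) continuous_on_subset by fastforce
  qed
  then show ?thesis by (metis surjI)
qed

text \<open>\<open>rep_circle\<close> picks an unspecified representative; commuting with the
  translation by 1 makes the value independent of that choice.\<close>

definition circle_map :: "(real \<Rightarrow> real) \<Rightarrow> circle \<Rightarrow> circle" where
  "circle_map H c = circle_proj (H (rep_circle c))"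

lemma circle_map_proj:
  assumes "\<And>x. H (x + 1) = H x + 1"
  shows "circle_map H (circle_proj x) = circle_proj (H x)"
proof -
  have "rep_circle (circle_proj x) - x \<in> \<int>"
    by (simp flip: circle_proj_eq_iff)
  then obtain k where "rep_circle (circle_proj x) = x + of_int k"
    by (metis Ints_cases add.commute diff_add_cancel)
  then show ?thesis
    using shift_int[of H 1 x k] assms by (simp add: circle_map_def circle_proj_eq_iff)
qed

lemma is_lift_circle_map:
  assumes "\<And>x. H (x + 1) = H x + 1" "continuous_on UNIV H"
  shows "is_lift H (circle_map H)"
  using assms by (simp add: is_lift_def circle_map_proj)

lemma circle_map_inverse:
  assumes "\<And>x. H (x + 1) = H x + 1" "\<And>x. J (x + 1) = J x + 1" "\<And>x. H (J x) = x"
  shows "circle_map H (circle_map J c) = c"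
  by (metis assms circle_map_proj circle_proj_surj)

section \<open>Differentiability on the line, inverse functions and circle diffeomorphisms\<close>

lemma Ck_real_1I:
  assumes "\<And>x. (F has_real_derivative F1 x) (at x)" "continuous_on UNIV F1"
  shows "Ck_real 1 F"
proof -
  have "deriv F = F1" using assms(1) DERIV_imp_deriv by blast
  then show ?thesis using assms by (auto simp: Ck_real_def real_differentiable_def)
qed

lemma Ck_real_1D:
  assumes "Ck_real 1 F"
  shows "(F has_real_derivative deriv F x) (at x)" "continuous_on UNIV (deriv F)"
  using assms by (auto simp: Ck_real_def DERIV_deriv_iff_real_differentiable)

lemma
  assumes "\<And>x. (F has_real_derivative F1 x) (at x)"
    "\<And>x. (F1 has_real_derivative F2 x) (at x)"
  shows deriv_funpow_1: "(deriv ^^ 1) F = F1" and deriv_funpow_2: "(deriv ^^ 2) F = F2"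
proof -
  have "deriv F = F1" "deriv F1 = F2" using assms DERIV_imp_deriv by blast+
  then show "(deriv ^^ 1) F = F1" "(deriv ^^ 2) F = F2" by (simp_all add: numeral_2_eq_2)
qed

lemma Ck_real_2I:
  assumes "\<And>x. (F has_real_derivative F1 x) (at x)"
    "\<And>x. (F1 has_real_derivative F2 x) (at x)" "continuous_on UNIV F2"
  shows "Ck_real 2 F"
proof -
  have "deriv F = F1" using assms DERIV_imp_deriv by blast
  then show ?thesis unfolding Ck_real_def deriv_funpow_2[OF assms(1,2)]
    using assms by (auto simp: less_2_cases_iff real_differentiable_def)
qed

lemma Ck_real_2D:
  assumes "Ck_real 2 F"
  shows "(F has_real_derivative deriv F x) (at x)"
    "(deriv F has_real_derivative deriv (deriv F) x) (at x)" "continuous_on UNIV (deriv (deriv F))"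
  using assms by (auto simp: Ck_real_def DERIV_deriv_iff_real_differentiable numeral_2_eq_2 less_Suc_eq)

lemma DERIV_inverse_lift:
  fixes H J :: "real \<Rightarrow> real"
  assumes "\<And>x. (H has_real_derivative H1 x) (at x)" "\<And>x. H1 x > 0"
    "\<And>x. H (J x) = x" "\<And>x. J (H x) = x"
  shows "(J has_real_derivative inverse (H1 (J x))) (at x)"
proof (rule DERIV_inverse_function[where a = "x - 1" and b = "x + 1"])
  show "(H has_real_derivative H1 (J x)) (at (J x))" by (rule assms)
  show "H1 (J x) \<noteq> 0" using assms(2)[of "J x"] by simp
  show "isCont J x"
    using isCont_inverse_function[of 1 "J x" J H] assms(3,4) DERIV_isCont[OF assms(1)] by simp
qed (use assms in auto)

text \<open>Carries an explicit pair of inverse lifts back to the circle. \<open>J\<close> has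
  derivative \<open>inverse (H1 (J x))\<close>, and differentiating once more involves only
  \<open>H1\<close>, \<open>H2\<close> and \<open>J\<close>, so \<open>J\<close> is as smooth as
  \<open>H\<close>.\<close>

lemma circle_diffeo_2_map:
  assumes H1: "\<And>x. (H has_real_derivative H1 x) (at x)"
    and H2: "\<And>x. (H1 has_real_derivative H2 x) (at x)" "continuous_on UNIV H2"
    and pos: "\<And>x. H1 x > 0" and per: "\<And>x. H (x + 1) = H x + 1"
    and inv: "\<And>x. H (J x) = x" "\<And>x. J (H x) = x"
  shows "circle_diffeo 2 (circle_map H)" "inv_into UNIV (circle_map H) = circle_map J"
    "is_lift H (circle_map H)" "is_lift J (circle_map J)"
proof -
  have perJ: "J (x + 1) = J x + 1" for x by (metis inv per)
  have J1: "(J has_real_derivative inverse (H1 (J x))) (at x)" for x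
    by (rule DERIV_inverse_lift[OF H1 pos inv])
  have contJ: "continuous_on UNIV J" and contH: "continuous_on UNIV H" and contH1: "continuous_on UNIV H1"
    using J1 H1 H2 by (meson DERIV_continuous_on has_field_derivative_at_within)+
  show liftJ: "is_lift J (circle_map J)" and liftH: "is_lift H (circle_map H)"
    by (intro is_lift_circle_map per perJ contJ contH)+
  have b: "circle_map J (circle_map H c) = c" "circle_map H (circle_map J c) = c" for c
    by (intro circle_map_inverse per perJ inv)+
  then have bij: "bij (circle_map H)" by (metis bijI' )
  then show invH: "inv_into UNIV (circle_map H) = circle_map J"
    using b by (metis inv_equality)
  have "((\<lambda>x. inverse (H1 (J x))) has_real_derivative
     - (inverse (H1 (J x)) * (H2 (J x) * inverse (H1 (J x))) * inverse (H1 (J x)))) (at x)" (is "(_ has_real_derivative ?J2 x) _") for x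
    using pos[of "J x"] by (intro DERIV_inverse' DERIV_chain2[OF H2(1) J1]) auto
  then have "Ck_real 2 J"
    by (intro Ck_real_2I[OF J1, of ?J2])
      (auto intro!: continuous_intros continuous_on_compose2[OF H2(2) contJ]
        continuous_on_compose2[OF contH1 contJ] simp: less_imp_neq[OF pos, symmetric])
  moreover have "Ck_real 2 H" using H1 H2 by (rule Ck_real_2I)
  moreover have "strict_mono H"
    by (rule strict_monoI) (metis DERIV_pos_imp_increasing H1 pos)
  ultimately show "circle_diffeo 2 (circle_map H)"
    using bij liftJ liftH by (auto simp: circle_diffeo_def Ck_circle_def orientation_preserving_def invH)
qed

text \<open>Smoothness of the map, smoothness of its inverse and orientation each come with a lift
  of their own. By uniqueness up to integers all of them can be matched to a single
  \<open>\<Phi>\<close>.\<close>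

lemma circle_diffeo_1_lifts:
  assumes "circle_diffeo 1 \<phi>"
  obtains \<Phi> \<Psi> where "is_lift \<Phi> \<phi>" "is_lift \<Psi> (inv_into UNIV \<phi>)"
    "\<And>x. (\<Phi> has_real_derivative deriv \<Phi> x) (at x)" "continuous_on UNIV (deriv \<Phi>)"
    "\<And>x. deriv \<Phi> x > 0" "\<And>x. \<Phi> (x + 1) = \<Phi> x + 1"
    "\<And>x. \<Phi> (\<Psi> x) = x" "\<And>x. \<Psi> (\<Phi> x) = x"
proof -
  let ?\<psi> = "inv_into UNIV \<phi>"
  have bij: "bij \<phi>" using assms by (simp add: circle_diffeo_def)
  obtain \<Phi> \<Psi>0 \<Phi>' where lift: "is_lift \<Phi> \<phi>" "is_lift \<Psi>0 ?\<psi>" "is_lift \<Phi>' \<phi>"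
    and C1: "Ck_real 1 \<Phi>" "Ck_real 1 \<Psi>0" and mono': "strict_mono \<Phi>'"
    using assms by (auto simp: circle_diffeo_def Ck_circle_def orientation_preserving_def)
  have "is_lift (\<Psi>0 \<circ> \<Phi>) id"
    using is_lift_comp[OF lift(2,1)] bij by (simp add: bij_is_inj)
  from is_lift_unique[OF this is_lift_id] obtain k where k: "\<And>x. \<Psi>0 (\<Phi> x) = x + of_int k"
    by (auto simp: comp_def)
  define \<Psi> where "\<Psi> = (\<lambda>x. \<Psi>0 x - of_int k)"
  have \<Psi>\<Phi>: "\<Psi> (\<Phi> x) = x" for x by (simp add: \<Psi>_def k)
  have "circle_proj (x - of_int k) = circle_proj x" for x
    by (simp add: circle_proj_eq_iff)
  then have lift\<Psi>: "is_lift \<Psi> ?\<psi>"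
    using lift(2) by (auto simp: is_lift_def \<Psi>_def intro!: continuous_intros)
  obtain l :: int where "\<And>x. \<Phi> x = \<Phi>' x + l"
    using is_lift_unique[OF lift(1,3)] by blast
  then have mono: "strict_mono \<Phi>" using mono' by (simp add: strict_mono_def)
  obtain d :: int where d: "\<And>x. \<Phi> (x + 1) = \<Phi> x + d" using lift_degree[OF lift(1)] by blast
  obtain e :: int where e: "\<And>x. \<Psi> (x + 1) = \<Psi> x + e" using lift_degree[OF lift\<Psi>] by blast
  \<comment> \<open>Evaluating \<open>\<Psi> (\<Phi> (x + 1))\<close> in two ways shows that the
    degrees multiply to 1; monotonicity then selects \<open>d = 1\<close>.\<close>
  have "x + 1 = x + of_int d * of_int e" for x :: real
    using shift_int[of \<Psi> e "\<Phi> x" d] e \<Psi>\<Phi>[of "x + 1"] by (simp add: d \<Psi>\<Phi>)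
  from this[of 0] have "real_of_int (d * e) = real_of_int 1" by simp
  then have "d * e = 1" by (simp only: of_int_eq_iff)
  moreover have "d > 0" using d[of 0] strict_monoD[OF mono, of 0 1] by simp
  ultimately have "d = 1" by (simp add: pos_zmult_eq_1_iff)
  then have per: "\<Phi> (x + 1) = \<Phi> x + 1" for x using d by simp
  have D\<Phi>: "(\<Phi> has_real_derivative deriv \<Phi> x) (at x)" for x by (rule Ck_real_1D[OF C1(1)])
  have contd: "continuous_on UNIV (deriv \<Phi>)" by (rule Ck_real_1D[OF C1(1)])
  have D\<Psi>: "(\<Psi> has_real_derivative deriv \<Psi>0 x) (at x)" for x
    unfolding \<Psi>_def by (auto intro!: derivative_eq_intros Ck_real_1D[OF C1(2)])
  have "surj \<Phi>" using per lift(1) by (intro surj_shift) (auto simp: is_lift_def)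
  then have \<Phi>\<Psi>: "\<Phi> (\<Psi> x) = x" for x by (metis \<Psi>\<Phi> surjD)
  \<comment> \<open>Monotonicity gives only a nonnegative derivative; the chain rule for
    \<open>\<Psi> (\<Phi> x) = x\<close> excludes zero.\<close>
  have "deriv \<Phi> x > 0" for x
  proof -
    have "((\<lambda>x. \<Psi> (\<Phi> x)) has_real_derivative deriv \<Psi>0 (\<Phi> x) * deriv \<Phi> x) (at x)"
      by (rule DERIV_chain2[OF D\<Psi> D\<Phi>])
    then have "deriv \<Psi>0 (\<Phi> x) * deriv \<Phi> x = 1"
      unfolding \<Psi>\<Phi> using DERIV_ident DERIV_unique by blast
    then have "deriv \<Phi> x \<noteq> 0" by auto
    moreover have "deriv \<Phi> x \<ge> 0"
      using strict_mono_mono[OF mono] by (intro mono_on_imp_deriv_nonneg[OF _ D\<Phi>, of UNIV]) auto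
    ultimately show ?thesis by simp
  qed
  then show thesis
    using that[of \<Phi> \<Psi>] lift(1) lift\<Psi> D\<Phi> contd per \<Phi>\<Psi> \<Psi>\<Phi> by blast
qed

section \<open>Continuous functions of period 1\<close>

lemma periodic_shift_int:
  fixes g :: "real \<Rightarrow> real"
  assumes "\<And>x. g (x + 1) = g x"
  shows "g (x + of_int k) = g x"
  using shift_int[of g 0 x k] assms by simp

lemma periodic_bounded:
  fixes g :: "real \<Rightarrow> real"
  assumes "continuous_on UNIV g" "\<And>x. g (x + 1) = g x"
  obtains B where "B > 0" "\<And>x. \<bar>g x\<bar> \<le> B"
proof -
  have "bounded (g ` {0..1})"
    using assms(1) by (intro compact_imp_bounded compact_continuous_image) (auto intro: continuous_on_subset)
  then obtain B where B: "B > 0" "\<And>x. x \<in> {0..1} \<Longrightarrow> \<bar>g x\<bar> \<le> B"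
    by (auto simp: bounded_pos)
  have "\<bar>g x\<bar> \<le> B" for x
  proof -
    have "g x = g (frac x)"
      using periodic_shift_int[of g "frac x" "\<lfloor>x\<rfloor>"] assms(2) by (simp add: frac_def)
    then show ?thesis using B(2)[of "frac x"] by (simp add: less_imp_le[OF frac_lt_1])
  qed
  with B(1) show thesis by (rule that)
qed

lemma periodic_uniformly_continuous:
  fixes g :: "real \<Rightarrow> real"
  assumes "continuous_on UNIV g" "\<And>x. g (x + 1) = g x" "\<epsilon> > 0"
  obtains \<delta> where "\<delta> > 0" "\<And>x y. \<bar>x - y\<bar> < \<delta> \<Longrightarrow> \<bar>g x - g y\<bar> < \<epsilon>"
proof -
  \<comment> \<open>One common integer translation moves \<open>x\<close> into [0, 1) and a point
    \<open>y\<close> at distance less than 1 into (-1, 2), so this compact interval serves all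
    pairs.\<close>
  have "uniformly_continuous_on {-1..2} g"
    using assms(1) by (intro compact_uniformly_continuous) (auto intro: continuous_on_subset)
  then obtain d where d: "d > 0"
    "\<And>x y. x \<in> {-1..2} \<Longrightarrow> y \<in> {-1..2} \<Longrightarrow> \<bar>x - y\<bar> < d \<Longrightarrow> \<bar>g x - g y\<bar> < \<epsilon>"
    using \<open>\<epsilon> > 0\<close> unfolding uniformly_continuous_on_def dist_real_def by metis
  have "\<bar>g x - g y\<bar> < \<epsilon>" if "\<bar>x - y\<bar> < min d 1" for x y
  proof -
    let ?k = "\<lfloor>x\<rfloor>"
    have "\<bar>g (x - of_int ?k) - g (y - of_int ?k)\<bar> < \<epsilon>"
      using that by (intro d(2)) (auto; linarith)+
    then show ?thesis
      using periodic_shift_int[of g "x - of_int ?k" ?k] periodic_shift_int[of g "y - of_int ?k" ?k] assms(2) by simp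
  qed
  then show thesis using that[of "min d 1"] d(1) by auto
qed

section \<open>The cocycle of a \<open>C\<^sup>1\<close> conjugacy\<close>

locale C1_conjugacy =
  fixes \<Phi> \<Phi>1 \<Psi> :: "real \<Rightarrow> real"
  assumes DERIV_\<Phi>: "\<And>x. (\<Phi> has_real_derivative \<Phi>1 x) (at x)"
    and cont_\<Phi>1: "continuous_on UNIV \<Phi>1"
    and \<Phi>1_pos: "\<And>x. \<Phi>1 x > 0"
    and \<Phi>_shift: "\<And>x. \<Phi> (x + 1) = \<Phi> x + 1"
    and \<Phi>_\<Psi> [simp]: "\<And>x. \<Phi> (\<Psi> x) = x"
    and \<Psi>_\<Phi> [simp]: "\<And>x. \<Psi> (\<Phi> x) = x"
begin

lemma \<Psi>_shift: "\<Psi> (x + 1) = \<Psi> x + 1"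
  by (metis \<Phi>_\<Psi> \<Psi>_\<Phi> \<Phi>_shift)

lemma \<Phi>1_shift: "\<Phi>1 (x + 1) = \<Phi>1 x"
proof -
  have "((\<lambda>x. \<Phi> (x + 1)) has_real_derivative \<Phi>1 (x + 1) * 1) (at x)"
    by (rule DERIV_chain2[OF DERIV_\<Phi>]) (auto intro!: derivative_eq_intros)
  moreover have "((\<lambda>x. \<Phi> (x + 1)) has_real_derivative \<Phi>1 x) (at x)"
    unfolding \<Phi>_shift by (auto intro!: derivative_eq_intros DERIV_\<Phi>)
  ultimately show ?thesis using DERIV_unique by fastforce
qed

lemma DERIV_\<Psi>: "(\<Psi> has_real_derivative inverse (\<Phi>1 (\<Psi> x))) (at x)"
  by (rule DERIV_inverse_lift[OF DERIV_\<Phi> \<Phi>1_pos \<Phi>_\<Psi> \<Psi>_\<Phi>])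

lemma cont_\<Phi>: "continuous_on UNIV \<Phi>" and cont_\<Psi>: "continuous_on UNIV \<Psi>"
  using DERIV_\<Phi> DERIV_\<Psi> by (meson DERIV_continuous_on has_field_derivative_at_within)+

definition A :: "real \<Rightarrow> real \<Rightarrow> real" where
  "A t y = ln (\<Phi>1 (y + t)) - ln (\<Phi>1 y)"

abbreviation a :: "real \<Rightarrow> real \<Rightarrow> real" where "a t \<equiv> deriv (A t)"

text \<open>These are the \<open>t\<close> for which \<open>G t\<close> is \<open>C^2\<close>.
  Phrased through the cocycle, closure under sums and negatives follows from additivity.\<close>

definition T :: "real set" where "T = {t. Ck_real 1 (A t)}"

lemma
  assumes "t \<in> T"
  shows DERIV_A: "(A t has_real_derivative a t y) (at y)" and cont_a: "continuous_on UNIV (a t)"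
  using assms Ck_real_1D by (auto simp: T_def)

lemma in_TI:
  assumes "\<And>y. (A t has_real_derivative a' y) (at y)" "continuous_on UNIV a'"
  shows "t \<in> T"
  using Ck_real_1I[OF assms] by (simp add: T_def)

lemma A_add: "A (s + t) = (\<lambda>y. A s (y + t) + A t y)"
  by (simp add: A_def fun_eq_iff add_ac)

lemma DERIV_A_add:
  assumes "s \<in> T" "t \<in> T"
  shows "(A (s + t) has_real_derivative a s (y + t) + a t y) (at y)"
  unfolding A_add
  by (rule DERIV_add[OF _ DERIV_A[OF assms(2)]])
    (use DERIV_A[OF assms(1), of "y + t"] in \<open>simp add: DERIV_shift\<close>)

lemma T_add:
  assumes "s \<in> T" "t \<in> T"
  shows "s + t \<in> T"
  using DERIV_A_add[OF assms]
  by (rule in_TI) (intro continuous_intros continuous_on_compose2[OF cont_a[OF assms(1)]] cont_a assms; simp)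

lemma a_add:
  assumes "s \<in> T" "t \<in> T"
  shows "a (s + t) y = a s (y + t) + a t y"
  using DERIV_A_add[OF assms] by (rule DERIV_imp_deriv)

lemma T_minus:
  assumes "t \<in> T"
  shows "- t \<in> T"
proof (rule in_TI)
  have "A (- t) = (\<lambda>y. - A t (y + - t))" by (simp add: A_def fun_eq_iff)
  then show "(A (- t) has_real_derivative - a t (y + - t)) (at y)" for y
    using DERIV_A[OF assms, of "y + - t"] by (auto intro!: DERIV_minus simp only: DERIV_shift)
  show "continuous_on UNIV (\<lambda>y. - a t (y + - t))"
    by (intro continuous_intros continuous_on_compose2[OF cont_a[OF assms]]; simp)
qed

lemma A_of_int: "A (of_int k) y = 0"
  using periodic_shift_int[of \<Phi>1 y k] \<Phi>1_shift by (simp add: A_def)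

lemma of_int_in_T: "of_int k \<in> T"
  by (rule in_TI[of _ "\<lambda>_. 0"]) (simp_all add: A_of_int[abs_def])

lemma zero_in_T: "0 \<in> T" using of_int_in_T[of 0] by simp

lemma a_zero: "a 0 y = 0"
  using a_add[OF zero_in_T zero_in_T, of y] by simp

lemma T_of_nat_mult: "t \<in> T \<Longrightarrow> real n * t \<in> T"
  by (induction n) (auto simp: algebra_simps intro: T_add zero_in_T)

lemma T_sum: "(\<And>s. s \<in> S \<Longrightarrow> s \<in> T) \<Longrightarrow> (\<Sum>s\<in>S. real (k s) * s) \<in> T"
  by (induction S rule: infinite_finite_induct) (auto intro: T_add T_of_nat_mult zero_in_T)

lemma a_shift: "t \<in> T \<Longrightarrow> a t (y + 1) = a t y"
proof -
  assume "t \<in> T"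
  have "A t (y + 1) = A t y" for y
  proof -
    have "y + 1 + t = y + t + 1" by simp
    then show ?thesis by (simp only: A_def \<Phi>1_shift)
  qed
  then have "(A t has_real_derivative a t (y + 1)) (at y)"
    using DERIV_A[OF \<open>t \<in> T\<close>, of "y + 1"] by (simp add: DERIV_shift)
  then show ?thesis using DERIV_imp_deriv by metis
qed

text \<open>\<open>A t\<close> is a difference of two values of the single bounded function
  \<open>ln (\<Phi>1 y)\<close>, hence a bound independent of \<open>t\<close>. This is where the
  \<open>C^1\<close> regularity of the conjugacy pays off.\<close>

lemma A_bounded: obtains K where "K > 0" "\<And>t y. \<bar>A t y\<bar> \<le> K"
proof -
  obtain K where K: "K > 0" "\<And>y. \<bar>ln (\<Phi>1 y)\<bar> \<le> K"
    by (rule periodic_bounded[of "\<lambda>y. ln (\<Phi>1 y)"])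
      (auto intro!: continuous_intros cont_\<Phi>1 simp: \<Phi>1_shift less_imp_neq[OF \<Phi>1_pos, symmetric])
  have "\<bar>A t y\<bar> \<le> 2 * K" for t y using K(2)[of "y + t"] K(2)[of y] by (simp add: A_def abs_le_iff)
  with K(1) show thesis using that[of "2 * K"] by simp
qed

text \<open>By the cocycle rule \<open>a (real n * t)\<close> is a sum of \<open>n\<close>
  translates of \<open>a t\<close>. Translating both points keeps their distance, so the moduli of
  continuity add up.\<close>

lemma a_modulus_mult:
  assumes t: "t \<in> T" and e: "\<And>y z. \<bar>y - z\<bar> < \<delta> \<Longrightarrow> \<bar>a t y - a t z\<bar> \<le> \<epsilon>" and "\<bar>y - z\<bar> < \<delta>"
  shows "\<bar>a (real n * t) y - a (real n * t) z\<bar> \<le> \<epsilon> * n"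
  using assms(3)
proof (induction n)
  case (Suc n)
  have "a (real (Suc n) * t) y = a t (y + real n * t) + a (real n * t) y" for y
    using a_add[OF t T_of_nat_mult[OF t]] by (simp add: algebra_simps)
  then show ?case using Suc e[of "y + real n * t" "z + real n * t"] by (simp add: algebra_simps)
qed (simp add: a_zero)

text \<open>The same addition over different generators: the oscillation grows with the number of
  summands while \<open>\<delta>\<close> stays fixed.\<close>

lemma a_modulus_sum:
  assumes S: "\<And>s. s \<in> S \<Longrightarrow> s \<in> T"
    and e: "\<And>s y z. s \<in> S \<Longrightarrow> \<bar>y - z\<bar> < \<delta> \<Longrightarrow> \<bar>a s y - a s z\<bar> \<le> \<epsilon>" and "\<bar>y - z\<bar> < \<delta>"
  shows "\<bar>a (\<Sum>s\<in>S. real (k s) * s) y - a (\<Sum>s\<in>S. real (k s) * s) z\<bar> \<le> \<epsilon> * (\<Sum>s\<in>S. real (k s))"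
  using assms
proof (induction S arbitrary: y z rule: infinite_finite_induct)
  case (insert s S)
  let ?r = "\<Sum>s\<in>S. real (k s) * s"
  have s: "s \<in> T" and r: "?r \<in> T" using insert T_sum by auto
  have "a (\<Sum>s\<in>insert s S. real (k s) * s) y = a (real (k s) * s) (y + ?r) + a ?r y" for y
    using a_add[OF T_of_nat_mult[OF s] r] insert by simp
  moreover have "\<bar>a ?r y - a ?r z\<bar> \<le> \<epsilon> * (\<Sum>s\<in>S. real (k s))"
    using insert by simp
  moreover have "\<bar>a (real (k s) * s) (y + ?r) - a (real (k s) * s) (z + ?r)\<bar> \<le> \<epsilon> * real (k s)"
    using insert by (intro a_modulus_mult[OF s, of \<delta>]) auto
  ultimately show ?case using insert(1,2) by (simp add: algebra_simps)
qed (simp_all add: a_zero)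

text \<open>A bounded function whose derivative oscillates little over a fixed length has a small
  derivative everywhere. The constant \<open>C\<close> depends on \<open>\<epsilon>\<close> through
  \<open>\<delta>\<close>, but not on \<open>k\<close> or \<open>y\<close>.\<close>

lemma a_sublinear:
  assumes fin: "finite S" and S: "\<And>s. s \<in> S \<Longrightarrow> s \<in> T" and \<epsilon>: "\<epsilon> > 0"
  obtains C where "\<And>k y. \<bar>a (\<Sum>s\<in>S. real (k s) * s) y\<bar> \<le> \<epsilon> * (\<Sum>s\<in>S. real (k s)) + C"
proof -
  have "\<exists>\<delta>>0. \<forall>y z. \<bar>y - z\<bar> < \<delta> \<longrightarrow> \<bar>a s y - a s z\<bar> < \<epsilon>" if "s \<in> S" for s
    using periodic_uniformly_continuous[OF cont_a a_shift \<epsilon>] S[OF that] by metis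
  then obtain d where d: "\<And>s. s \<in> S \<Longrightarrow> d s > 0"
    "\<And>s y z. s \<in> S \<Longrightarrow> \<bar>y - z\<bar> < d s \<Longrightarrow> \<bar>a s y - a s z\<bar> < \<epsilon>"
    by metis
  \<comment> \<open>The inserted 1 keeps the minimum meaningful for empty \<open>S\<close>.\<close>
  obtain \<delta> where \<delta>: "\<delta> > 0" "\<And>s. s \<in> S \<Longrightarrow> \<delta> \<le> d s"
  proof
    show "Min (insert 1 (d ` S)) > 0" "\<And>s. s \<in> S \<Longrightarrow> Min (insert 1 (d ` S)) \<le> d s"
      using fin d(1) by auto
  qed
  obtain K where K: "\<And>t y. \<bar>A t y\<bar> \<le> K" using A_bounded by metis
  have "\<bar>a (\<Sum>s\<in>S. real (k s) * s) y\<bar> \<le> \<epsilon> * (\<Sum>s\<in>S. real (k s)) + 2 * K / (\<delta> / 2)" for k y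
  proof -
    let ?t = "\<Sum>s\<in>S. real (k s) * s"
    have t: "?t \<in> T" using S by (rule T_sum)
    \<comment> \<open>The mean slope over length \<open>\<delta> / 2\<close> is controlled by the
      bound \<open>K\<close> on \<open>A\<close>, so the derivative is bounded at one point
      \<open>z\<close>; the modulus then carries the bound from \<open>z\<close> to
      \<open>y\<close>.\<close>
    obtain z where z: "y < z" "z < y + \<delta> / 2" "A ?t (y + \<delta> / 2) - A ?t y = (y + \<delta> / 2 - y) * a ?t z"
      using MVT2[of y "y + \<delta> / 2" "A ?t" "a ?t"] DERIV_A[OF t] \<delta>(1) by auto
    have "\<bar>A ?t (y + \<delta> / 2) - A ?t y\<bar> \<le> 2 * K"
      using K[of ?t y] K[of ?t "y + \<delta> / 2"] by linarith
    then have "\<bar>a ?t z\<bar> \<le> 2 * K / (\<delta> / 2)"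
      using z(3) \<delta>(1) by (simp add: field_simps abs_mult)
    moreover have "\<bar>a ?t y - a ?t z\<bar> \<le> \<epsilon> * (\<Sum>s\<in>S. real (k s))"
      using z \<delta> by (intro a_modulus_sum[OF S, of _ \<delta>] less_imp_le[OF d(2)]) (auto intro: less_le_trans)
    ultimately show ?thesis by linarith
  qed
  then show thesis by (rule that)
qed

section \<open>The lifts of conjugated rotations and their first two derivatives\<close>

definition G :: "real \<Rightarrow> real \<Rightarrow> real" where "G t x = \<Phi> (\<Psi> x + t)"
text \<open>This is the quotient of \<open>\<Phi>1 (\<Psi> x + t)\<close> by
  \<open>\<Phi>1 (\<Psi> x)\<close>, written as an exponential so that the bound on \<open>A\<close>
  passes directly to it.\<close>

definition G1 :: "real \<Rightarrow> real \<Rightarrow> real" where "G1 t x = exp (A t (\<Psi> x))"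
definition G2 :: "real \<Rightarrow> real \<Rightarrow> real" where
  "G2 t x = G1 t x * (a t (\<Psi> x) * inverse (\<Phi>1 (\<Psi> x)))"

lemma DERIV_G: "(G t has_real_derivative G1 t x) (at x)"
proof -
  have "((\<lambda>x. \<Phi> (\<Psi> x + t)) has_real_derivative \<Phi>1 (\<Psi> x + t) * inverse (\<Phi>1 (\<Psi> x))) (at x)"
    by (rule DERIV_chain2[OF DERIV_\<Phi>]) (auto intro!: derivative_eq_intros DERIV_\<Psi>)
  also have "\<Phi>1 (\<Psi> x + t) * inverse (\<Phi>1 (\<Psi> x)) = G1 t x"
    by (simp add: G1_def A_def exp_diff \<Phi>1_pos divide_inverse)
  finally show ?thesis unfolding G_def[abs_def] .
qed

lemma DERIV_G1: "t \<in> T \<Longrightarrow> (G1 t has_real_derivative G2 t x) (at x)"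
  unfolding G2_def G1_def[abs_def]
  by (rule DERIV_chain2[OF DERIV_exp]) (rule DERIV_chain2[OF DERIV_A DERIV_\<Psi>])

lemma cont_G1: "t \<in> T \<Longrightarrow> continuous_on UNIV (G1 t)"
  using DERIV_G1 by (meson DERIV_continuous_on has_field_derivative_at_within)

lemma cont_G2: "t \<in> T \<Longrightarrow> continuous_on UNIV (G2 t)"
  unfolding G2_def[abs_def]
  by (intro continuous_intros cont_G1 continuous_on_compose2[OF cont_a cont_\<Psi>]
      continuous_on_compose2[OF cont_\<Phi>1 cont_\<Psi>])
    (auto simp: less_imp_neq[OF \<Phi>1_pos, symmetric])

text \<open>\<open>A t\<close> is recovered as \<open>ln (G1 t (\<Phi> y))\<close>. If
  \<open>G1 t\<close> is \<open>C^1\<close>, so is this, because composing with the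
  \<open>C^1\<close> map \<open>\<Phi>\<close> costs no regularity here.\<close>

lemma in_T_if_C2:
  assumes "Ck_real 2 (G t)"
  shows "t \<in> T"
proof (rule in_TI)
  let ?g = "deriv (deriv (G t))"
  have "deriv (G t) = G1 t" using DERIV_G DERIV_imp_deriv by blast
  then have D: "(G1 t has_real_derivative ?g x) (at x)" and c: "continuous_on UNIV ?g" for x
    using Ck_real_2D[OF assms] by metis+
  have "A t = (\<lambda>y. ln (G1 t (\<Phi> y)))" by (simp add: G1_def)
  then show "(A t has_real_derivative 1 / (G1 t (\<Phi> y)) * (?g (\<Phi> y) * \<Phi>1 y)) (at y)" for y
    by (simp only:) (intro DERIV_chain2[OF DERIV_ln_divide] DERIV_chain2[OF D DERIV_\<Phi>], simp add: G1_def)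
  have "continuous_on UNIV (G1 t)"
    using D by (meson DERIV_continuous_on has_field_derivative_at_within)
  then show "continuous_on UNIV (\<lambda>y. 1 / (G1 t (\<Phi> y)) * (?g (\<Phi> y) * \<Phi>1 y))"
    by (intro continuous_intros cont_\<Phi>1 continuous_on_compose2[OF _ cont_\<Phi>, of UNIV] c) (auto simp: G1_def)
qed

lemma G_G: "G s (G t x) = G (s + t) x" by (simp add: G_def add_ac)

lemma G_shift: "G t (x + 1) = G t x + 1"
proof -
  have "\<Psi> x + 1 + t = \<Psi> x + t + 1" by simp
  then show ?thesis by (simp only: G_def \<Psi>_shift \<Phi>_shift)
qed

lemma G_of_int: "G (of_int k) x = x + of_int k"
  using shift_int[of \<Phi> 1 "\<Psi> x" k] \<Phi>_shift by (simp add: G_def)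

lemma G1_chain: "G1 (s + t) x = G1 s (G t x) * G1 t x"
  by (simp add: G1_def A_add G_def exp_add)

lemma G2_chain:
  assumes "s \<in> T" "t \<in> T"
  shows "G2 (s + t) x = G2 s (G t x) * (G1 t x)\<^sup>2 + G1 s (G t x) * G2 t x"
proof -
  have "G1 (s + t) = (\<lambda>x. G1 s (G t x) * G1 t x)" using G1_chain by blast
  moreover have "((\<lambda>x. G1 s (G t x) * G1 t x) has_real_derivative
     (G2 s (G t x) * G1 t x) * G1 t x + G2 t x * G1 s (G t x)) (at x)"
    by (intro DERIV_mult DERIV_chain2[OF DERIV_G1 DERIV_G] DERIV_G1 assms)
  ultimately show ?thesis
    using DERIV_unique[OF DERIV_G1[OF T_add[OF assms]]] by (simp add: power2_eq_square algebra_simps)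
qed

lemma G1_bounded: obtains M where "M > 0" "\<And>t x. G1 t x \<le> M" "\<And>t x. G1 t x \<ge> inverse M"
proof -
  obtain K where K: "\<And>t y. \<bar>A t y\<bar> \<le> K" using A_bounded by metis
  show thesis
  proof (rule that[of "exp K"])
    show "G1 t x \<le> exp K" "G1 t x \<ge> inverse (exp K)" for t x
      using K[of t "\<Psi> x"] by (simp_all add: G1_def abs_le_iff flip: exp_minus)
  qed simp
qed

text \<open>Since \<open>M\<close> does not depend on \<open>t\<close>, the sublinear growth of
  \<open>a\<close> passes to the second derivatives.\<close>

lemma G2_le_a: obtains M where "M > 0" "\<And>t x. \<bar>G2 t x\<bar> \<le> M * \<bar>a t (\<Psi> x)\<bar>"
proof -
  obtain M where M: "M > 0" "\<And>t x. G1 t x \<le> M" using G1_bounded by metis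
  obtain P where P: "P > 0" "\<And>y. \<bar>inverse (\<Phi>1 y)\<bar> \<le> P"
    by (rule periodic_bounded[of "\<lambda>y. inverse (\<Phi>1 y)"])
      (auto intro!: continuous_intros cont_\<Phi>1 simp: \<Phi>1_shift less_imp_neq[OF \<Phi>1_pos, symmetric])
  have "\<bar>G2 t x\<bar> \<le> (M * P) * \<bar>a t (\<Psi> x)\<bar>" for t x
  proof -
    have "\<bar>G2 t x\<bar> = G1 t x * \<bar>inverse (\<Phi>1 (\<Psi> x))\<bar> * \<bar>a t (\<Psi> x)\<bar>"
      by (simp add: G2_def abs_mult G1_def)
    also have "\<dots> \<le> M * P * \<bar>a t (\<Psi> x)\<bar>"
      using M P by (intro mult_mono) (auto simp: G1_def)
    finally show ?thesis .
  qed
  then show thesis using that[of "M * P"] M P by simp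
qed

lemma G2_bounded:
  assumes "t \<in> T"
  obtains C where "C > 0" "\<And>x. \<bar>G2 t x\<bar> \<le> C"
proof -
  obtain M where M: "M > 0" "\<And>t x. \<bar>G2 t x\<bar> \<le> M * \<bar>a t (\<Psi> x)\<bar>" using G2_le_a by metis
  obtain B where B: "B > 0" "\<And>y. \<bar>a t y\<bar> \<le> B"
    using periodic_bounded[OF cont_a a_shift] assms by metis
  have "\<bar>G2 t x\<bar> \<le> M * B" for x
    using M(2)[of t x] mult_left_mono[OF B(2)[of "\<Psi> x"], of M] M(1) by linarith
  then show thesis using that[of "M * B"] M B by simp
qed

end

section \<open>Averages over boxes\<close>

text \<open>Splitting off one coordinate lets a box sum telescope along a single generator.\<close>

lemma sum_PiE_insert:
  fixes f :: "('a \<Rightarrow> 'b) \<Rightarrow> 'c::comm_monoid_add"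
  assumes "s \<notin> S"
  shows "(\<Sum>k\<in>PiE (insert s S) B. f k) = (\<Sum>k\<in>PiE S B. \<Sum>i\<in>B s. f (k(s := i)))"
proof -
  have "(\<Sum>k\<in>PiE (insert s S) B. f k) = (\<Sum>(i, k)\<in>B s \<times> PiE S B. f (k(s := i)))"
    unfolding PiE_insert_eq
    by (subst sum.reindex[OF inj_combinator[OF assms]]) (simp add: case_prod_unfold comp_def)
  also have "\<dots> = (\<Sum>k\<in>PiE S B. \<Sum>i\<in>B s. f (k(s := i)))"
    by (subst sum.swap) (simp add: sum.cartesian_product)
  finally show ?thesis .
qed

lemma uniform_limit_zero_mult_bounded:
  fixes f g :: "nat \<Rightarrow> 'a \<Rightarrow> real"
  assumes lim: "uniform_limit UNIV f (\<lambda>_. 0) sequentially" and g: "\<And>n x. \<bar>g n x\<bar> \<le> B"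
  shows "uniform_limit UNIV (\<lambda>n x. f n x * g n x) (\<lambda>_. 0) sequentially"
proof (rule uniform_limit_null_comparison)
  show "\<forall>\<^sub>F n in sequentially. \<forall>x\<in>UNIV. norm (f n x * g n x) \<le> B * \<bar>f n x\<bar>"
    using mult_right_mono[OF g, of "\<bar>f _ _\<bar>"] by (intro always_eventually) (auto simp: abs_mult mult.commute)
  have "uniform_limit UNIV (\<lambda>n x. B * \<bar>f n x\<bar>) (\<lambda>x. B * 0) sequentially"
    using lim by (intro uniform_limit_intros) (simp add: uniform_limit_iff)
  then show "uniform_limit UNIV (\<lambda>n x. B * \<bar>f n x\<bar>) (\<lambda>_. 0) sequentially" by simp
qed

lemma uniform_limit_compose_right:
  assumes "uniform_limit UNIV f (\<lambda>_. c) F"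
  shows "uniform_limit UNIV (\<lambda>n x. f n (g n x)) (\<lambda>_. c) F"
  using assms by (auto simp: uniform_limit_iff elim!: eventually_mono)

lemma uniform_limit_inverse_Suc:
  fixes f :: "nat \<Rightarrow> 'a \<Rightarrow> real"
  assumes "\<And>n x. \<bar>f n x\<bar> \<le> C / real (Suc n)"
  shows "uniform_limit UNIV f (\<lambda>_. 0) sequentially"
proof (rule uniform_limit_null_comparison)
  show "\<forall>\<^sub>F n in sequentially. \<forall>x\<in>UNIV. norm (f n x) \<le> C / real (Suc n)"
    using assms by simp
  have "(\<lambda>n. C / real (Suc n)) \<longlonglongrightarrow> 0" by real_asymp
  then show "uniform_limit UNIV (\<lambda>n x. C / real (Suc n)) (\<lambda>_. 0) sequentially"
    by (simp add: uniform_limit_iff tendsto_iff)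
qed

section \<open>Means and differences over boxes of coefficient vectors\<close>

locale C1_conjugacy_box = C1_conjugacy +
  fixes S :: "real set"
  assumes finite_S: "finite S" and S_T: "\<And>s. s \<in> S \<Longrightarrow> s \<in> T"
begin

definition comb :: "(real \<Rightarrow> nat) \<Rightarrow> real" where "comb k = (\<Sum>s\<in>S. real (k s) * s)"

definition box :: "nat \<Rightarrow> (real \<Rightarrow> nat) set" where "box n = PiE S (\<lambda>_. {..n})"

text \<open>The sum runs over coefficient vectors, not over the numbers \<open>comb k\<close>: a
  number represented several times counts with multiplicity, so relations among the generators do no
  harm.\<close>

definition mean :: "nat \<Rightarrow> (real \<Rightarrow> real) \<Rightarrow> real" where
  "mean n X = (\<Sum>k\<in>box n. X (comb k)) / real (card (box n))"

text \<open>For \<open>X u = G u x\<close> this is the change of the averaged map \<open>H n\<close>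
  between \<open>x\<close> and \<open>G t x\<close>.\<close>

definition diff :: "nat \<Rightarrow> real \<Rightarrow> (real \<Rightarrow> real) \<Rightarrow> real" where
  "diff n t X = mean n (\<lambda>u. X (u + t) - X u)"

lemma comb_T: "comb k \<in> T" unfolding comb_def by (intro T_sum S_T)

lemma card_box_pos: "card (box n) > 0"
  using finite_S by (simp add: box_def card_PiE)

lemma mean_cong: "(\<And>k. X (comb k) = Y (comb k)) \<Longrightarrow> mean n X = mean n Y"
  by (simp add: mean_def)

lemma mean_const: "mean n (\<lambda>_. c) = c"
  using card_box_pos[of n] by (simp add: mean_def)

lemma mean_add: "mean n (\<lambda>u. X u + Y u) = mean n X + mean n Y"
  by (simp add: mean_def sum.distrib add_divide_distrib)

lemma mean_diff: "mean n (\<lambda>u. X u - Y u) = mean n X - mean n Y"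
  by (simp add: mean_def sum_subtractf diff_divide_distrib)

lemma mean_mult: "mean n (\<lambda>u. X u * c) = mean n X * c"
  by (simp add: mean_def sum_distrib_right)

lemma mean_mono: "(\<And>k. k \<in> box n \<Longrightarrow> X (comb k) \<le> Y (comb k)) \<Longrightarrow> mean n X \<le> mean n Y"
  unfolding mean_def by (intro divide_right_mono sum_mono) auto

lemma mean_abs_le:
  assumes "\<And>k. k \<in> box n \<Longrightarrow> \<bar>X (comb k)\<bar> \<le> B"
  shows "\<bar>mean n X\<bar> \<le> B"
proof -
  have "mean n X \<le> B" "- B \<le> mean n X"
    using mean_mono[of n X "\<lambda>_. B"] mean_mono[of n "\<lambda>_. - B" X] assms
    by (simp_all add: mean_const abs_le_iff minus_le_iff)
  then show ?thesis by linarith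
qed

lemma DERIV_mean:
  assumes "\<And>k. ((\<lambda>x. X x (comb k)) has_real_derivative X' (comb k)) (at x)"
  shows "((\<lambda>x. mean n (X x)) has_real_derivative mean n X') (at x)"
  unfolding mean_def by (intro DERIV_cdivide DERIV_sum assms)

lemma cont_mean:
  assumes "\<And>k. continuous_on UNIV (\<lambda>x. X x (comb k))"
  shows "continuous_on UNIV (\<lambda>x. mean n (X x))"
  unfolding mean_def using card_box_pos[of n] by (intro continuous_intros assms) simp

lemma diff_add:
  "diff n (t + u) X = diff n t (\<lambda>v. X (v + u)) + diff n u X"
  by (simp add: diff_def mean_add[symmetric] add_ac)

text \<open>Adding \<open>s\<close> raises one coefficient by 1, so along that coordinate the sum
  telescopes to two opposite faces. The upper face lies one step outside the box, hence the bound on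
  \<open>X\<close> up to \<open>Suc n\<close>.\<close>

lemma diff_generator:
  assumes s: "s \<in> S"
    and B: "\<And>k. (\<And>r. r \<in> S \<Longrightarrow> k r \<le> Suc n) \<Longrightarrow> \<bar>X (comb k)\<bar> \<le> B"
  shows "\<bar>diff n s X\<bar> \<le> 2 * B / real (Suc n)"
proof -
  let ?S = "S - {s}"
  let ?P = "PiE ?S (\<lambda>_. {..n})"
  have S_eq: "insert s ?S = S" using s by auto
  have comb_upd: "comb (k(s := i)) = (\<Sum>r\<in>?S. real (k r) * r) + real i * s" for k i
    unfolding comb_def using s finite_S by (subst sum.remove[of _ s]) (auto intro: sum.cong)
  \<comment> \<open>The face is smaller than the box by the factor \<open>Suc n\<close>, which is
    the source of the decay.\<close>
  have card: "card (box n) = Suc n * card ?P"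
    using s finite_S prod.remove[of S s "\<lambda>_. Suc n"] by (simp only: box_def card_PiE finite_Diff card_atMost)
  have "card ?P > 0" using finite_S by (simp add: card_PiE)
  have "\<bar>\<Sum>i\<le>n. X (comb (k(s := i)) + s) - X (comb (k(s := i)))\<bar> \<le> 2 * B" if k: "k \<in> ?P" for k
  proof -
    have "X (comb (k(s := i)) + s) = X (comb (k(s := Suc i)))" for i
      by (simp add: comb_upd algebra_simps)
    then have "(\<Sum>i\<le>n. X (comb (k(s := i)) + s) - X (comb (k(s := i))))
        = X (comb (k(s := Suc n))) - X (comb (k(s := 0)))"
      using sum_telescope[of "\<lambda>i. - X (comb (k(s := i)))" n] by simp
    moreover have "\<bar>X (comb (k(s := i)))\<bar> \<le> B" if "i \<le> Suc n" for i
      using that k by (intro B) (auto simp: PiE_iff le_Suc_eq)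
    from this[of "Suc n"] this[of 0] have "\<bar>X (comb (k(s := Suc n)))\<bar> \<le> B" "\<bar>X (comb (k(s := 0)))\<bar> \<le> B"
      by simp_all
    ultimately show ?thesis by linarith
  qed
  then have "\<bar>\<Sum>k\<in>box n. X (comb k + s) - X (comb k)\<bar> \<le> (\<Sum>k\<in>?P. 2 * B)"
    unfolding box_def
    by (subst S_eq[symmetric], subst sum_PiE_insert, simp, intro order.trans[OF sum_abs sum_mono]) blast
  then have "\<bar>\<Sum>k\<in>box n. X (comb k + s) - X (comb k)\<bar> \<le> real (card ?P) * (2 * B)" by simp
  then have "\<bar>diff n s X\<bar> \<le> (real (card ?P) * (2 * B)) / real (card (box n))"
    unfolding diff_def mean_def by (simp add: divide_right_mono)
  also have "\<dots> = 2 * B / real (Suc n)"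
    using \<open>card ?P > 0\<close> by (simp only: card of_nat_mult) simp
  finally show ?thesis .
qed

section \<open>Growth of second derivatives and well-behaved translation numbers\<close>

lemma G2_box_sublinear:
  assumes "\<epsilon> > 0"
  shows "\<forall>\<^sub>F n in sequentially. \<forall>k x. (\<forall>r\<in>S. k r \<le> Suc n) \<longrightarrow> \<bar>G2 (comb k) x\<bar> \<le> \<epsilon> * real (Suc n)"
proof -
  obtain M where M: "M > 0" "\<And>t x. \<bar>G2 t x\<bar> \<le> M * \<bar>a t (\<Psi> x)\<bar>" using G2_le_a by metis
  \<comment> \<open>The coefficients sum to at most \<open>card S\<close> times
    \<open>Suc n\<close>; the extra 1 keeps \<open>d\<close> positive for empty
    \<open>S\<close>.\<close>
  define d where "d = real (card S) + 1"
  then have d: "d > 0" by simp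
  \<comment> \<open>Chosen so that \<open>M * e * d = \<epsilon> / 2\<close>; the other half absorbs
    the constant \<open>M * C\<close> once \<open>n\<close> is large.\<close>
  define e where "e = \<epsilon> / (2 * M * d)"
  have e: "e > 0" using assms M d by (simp add: e_def)
  obtain C where C: "\<And>k y. \<bar>a (comb k) y\<bar> \<le> e * (\<Sum>s\<in>S. real (k s)) + C"
    using a_sublinear[OF finite_S S_T e] unfolding comb_def by metis
  have "filterlim (\<lambda>n. \<epsilon> / 2 * real (Suc n)) at_top sequentially"
    using assms by real_asymp
  then have "\<forall>\<^sub>F n in sequentially. M * C \<le> \<epsilon> / 2 * real (Suc n)"
    by (simp add: filterlim_at_top)
  then show ?thesis
  proof (eventually_elim, intro allI impI)
    fix n k x
    assume n: "M * C \<le> \<epsilon> / 2 * real (Suc n)" and k: "\<forall>r\<in>S. k r \<le> Suc n"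
    have "(\<Sum>s\<in>S. real (k s)) \<le> (\<Sum>s\<in>S. real (Suc n))"
      using k by (intro sum_mono) (simp only: of_nat_le_iff)
    also have "\<dots> \<le> d * real (Suc n)" by (simp add: d_def algebra_simps)
    finally have "e * (\<Sum>s\<in>S. real (k s)) \<le> e * (d * real (Suc n))"
      using e by (intro mult_left_mono) auto
    with C[of k "\<Psi> x"] have "\<bar>a (comb k) (\<Psi> x)\<bar> \<le> e * (d * real (Suc n)) + C" by linarith
    then have "M * \<bar>a (comb k) (\<Psi> x)\<bar> \<le> M * (e * (d * real (Suc n)) + C)"
      using M(1) by (intro mult_left_mono) auto
    also have "\<dots> = M * e * d * real (Suc n) + M * C" by (simp add: algebra_simps)
    also have "M * e * d = \<epsilon> / 2" using M(1) d by (simp add: e_def)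
    finally show "\<bar>G2 (comb k) x\<bar> \<le> \<epsilon> * real (Suc n)" using M(2)[of "comb k" x] n by linarith
  qed
qed

text \<open>The first derivative carries a rate instead of a mere limit, because it will be
  multiplied by the second derivative of \<open>H n\<close>, known only to be
  \<open>o(n)\<close>.\<close>

definition good :: "real set" where
  "good = {t \<in> T.
     uniform_limit UNIV (\<lambda>n x. diff n t (\<lambda>u. G u x)) (\<lambda>_. t) sequentially \<and>
     (\<exists>C. \<forall>n x. \<bar>diff n t (\<lambda>u. G1 u x)\<bar> \<le> C / real (Suc n)) \<and>
     uniform_limit UNIV (\<lambda>n x. diff n t (\<lambda>u. G2 u x)) (\<lambda>_. 0) sequentially}"

lemma goodI:
  assumes "t \<in> T"
    "uniform_limit UNIV (\<lambda>n x. diff n t (\<lambda>u. G u x)) (\<lambda>_. t) sequentially"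
    "\<And>n x. \<bar>diff n t (\<lambda>u. G1 u x)\<bar> \<le> C / real (Suc n)"
    "uniform_limit UNIV (\<lambda>n x. diff n t (\<lambda>u. G2 u x)) (\<lambda>_. 0) sequentially"
  shows "t \<in> good"
  using assms by (auto simp: good_def)

lemma goodD:
  assumes "t \<in> good"
  shows "t \<in> T"
    "uniform_limit UNIV (\<lambda>n x. diff n t (\<lambda>u. G u x)) (\<lambda>_. t) sequentially"
    "uniform_limit UNIV (\<lambda>n x. diff n t (\<lambda>u. G2 u x)) (\<lambda>_. 0) sequentially"
    "\<exists>C. \<forall>n x. \<bar>diff n t (\<lambda>u. G1 u x)\<bar> \<le> C / real (Suc n)"
  using assms by (auto simp: good_def)

text \<open>All three properties come from telescoping, applied to a bounded function twice and to
  the sublinear \<open>G2\<close> once.\<close>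

lemma good_generator:
  assumes s: "s \<in> S"
  shows "s \<in> good"
proof -
  obtain M where "\<And>t x. G1 t x \<le> M" using G1_bounded by metis
  then have M: "\<bar>G1 t x\<bar> \<le> M" for t x by (simp add: G1_def)
  show ?thesis
  proof (rule goodI[OF S_T[OF s]])
    show "\<bar>diff n s (\<lambda>u. G1 u x)\<bar> \<le> 2 * M / real (Suc n)" for n x
      by (intro diff_generator[OF s] M)
    \<comment> \<open>\<open>G u x\<close> is unbounded in \<open>u\<close>, so telescoping is
      applied to \<open>G u x - (\<Psi> x + u)\<close>, a value of the bounded function
      \<open>\<Phi> y - y\<close>. The subtracted part contributes exactly \<open>s\<close>.\<close>
    obtain Q where Q: "\<And>y. \<bar>\<Phi> y - y\<bar> \<le> Q"
      by (rule periodic_bounded[of "\<lambda>y. \<Phi> y - y"]) (auto intro!: continuous_intros cont_\<Phi> simp: \<Phi>_shift)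
    have "\<bar>diff n s (\<lambda>u. G u x) - s\<bar> \<le> 2 * Q / real (Suc n)" for n x
    proof -
      have "diff n s (\<lambda>u. G u x - (\<Psi> x + u)) = diff n s (\<lambda>u. G u x) - mean n (\<lambda>_. s)"
        unfolding diff_def mean_diff[symmetric] by (simp add: algebra_simps)
      then have "diff n s (\<lambda>u. G u x) - s = diff n s (\<lambda>u. G u x - (\<Psi> x + u))"
        by (simp add: mean_const)
      also have "\<bar>\<dots>\<bar> \<le> 2 * Q / real (Suc n)"
        using Q by (intro diff_generator[OF s]) (simp add: G_def)
      finally show ?thesis .
    qed
    then have "uniform_limit UNIV (\<lambda>n x. diff n s (\<lambda>u. G u x) - s) (\<lambda>_. 0) sequentially"
      by (rule uniform_limit_inverse_Suc)
    then show "uniform_limit UNIV (\<lambda>n x. diff n s (\<lambda>u. G u x)) (\<lambda>_. s) sequentially"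
      by (simp add: uniform_limit_iff dist_real_def)
  next
    show "uniform_limit UNIV (\<lambda>n x. diff n s (\<lambda>u. G2 u x)) (\<lambda>_. 0) sequentially"
    proof (rule uniform_limitI)
      fix \<epsilon> :: real
      assume "\<epsilon> > 0"
      \<comment> \<open>Telescoping doubles the bound, and two thirds of \<open>\<epsilon>\<close>
        still leaves a strict inequality.\<close>
      then have "\<epsilon> / 3 > 0" by simp
      from G2_box_sublinear[OF this]
      show "\<forall>\<^sub>F n in sequentially. \<forall>x\<in>UNIV. dist (diff n s (\<lambda>u. G2 u x)) 0 < \<epsilon>"
      proof (eventually_elim, intro ballI)
        fix n x
        assume "\<forall>k x. (\<forall>r\<in>S. k r \<le> Suc n) \<longrightarrow> \<bar>G2 (comb k) x\<bar> \<le> \<epsilon> / 3 * real (Suc n)"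
        then have "\<bar>diff n s (\<lambda>u. G2 u x)\<bar> \<le> 2 * (\<epsilon> / 3 * real (Suc n)) / real (Suc n)"
          by (intro diff_generator[OF s]) auto
        also have "\<dots> = 2 * \<epsilon> / 3" by (simp del: of_nat_Suc)
        finally show "dist (diff n s (\<lambda>u. G2 u x)) 0 < \<epsilon>" using \<open>\<epsilon> > 0\<close> by simp
      qed
    qed
  qed
qed

lemma diff_G_add: "diff n (t + u) (\<lambda>v. G v x) = diff n t (\<lambda>v. G v (G u x)) + diff n u (\<lambda>v. G v x)"
  by (simp add: diff_add G_G)

lemma diff_G1_add:
  "diff n (t + u) (\<lambda>v. G1 v x) = diff n t (\<lambda>v. G1 v (G u x)) * G1 u x + diff n u (\<lambda>v. G1 v x)"
proof -
  have "diff n t (\<lambda>v. G1 (v + u) x) = diff n t (\<lambda>v. G1 v (G u x)) * G1 u x"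
    unfolding diff_def mean_mult[symmetric] by (simp only: G1_chain[of _ u] left_diff_distrib)
  then show ?thesis by (simp add: diff_add)
qed

lemma diff_G2_add:
  assumes "t \<in> T" "u \<in> T"
  shows "diff n (t + u) (\<lambda>v. G2 v x) = diff n t (\<lambda>v. G2 v (G u x)) * (G1 u x)\<^sup>2
    + diff n t (\<lambda>v. G1 v (G u x)) * G2 u x + diff n u (\<lambda>v. G2 v x)"
proof -
  have "diff n t (\<lambda>v. G2 (v + u) x) = diff n t (\<lambda>v. G2 v (G u x)) * (G1 u x)\<^sup>2
    + diff n t (\<lambda>v. G1 v (G u x)) * G2 u x"
    unfolding diff_def mean_mult[symmetric] mean_add[symmetric]
    by (rule mean_cong) (simp only: G2_chain[OF _ assms(2)] comb_T T_add assms, simp add: algebra_simps)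
  then show ?thesis by (simp add: diff_add)
qed

text \<open>The differences along \<open>t\<close> are taken at \<open>G u x\<close>, which
  uniformity in \<open>x\<close> permits, and are multiplied by derivatives of the fixed map
  \<open>G u\<close>, which are bounded. The cross term in the second derivative vanishes by the
  rate for \<open>G1\<close>.\<close>

lemma good_add:
  assumes t: "t \<in> good" and u: "u \<in> good"
  shows "t + u \<in> good"
proof -
  obtain C where C: "\<And>n x. \<bar>diff n t (\<lambda>u. G1 u x)\<bar> \<le> C / real (Suc n)" using goodD[OF t] by auto
  obtain D where D: "\<And>n x. \<bar>diff n u (\<lambda>u. G1 u x)\<bar> \<le> D / real (Suc n)" using goodD[OF u] by auto
  obtain M where M: "M > 0" "\<And>t x. G1 t x \<le> M" using G1_bounded by metis
  then have absM: "\<bar>G1 t x\<bar> \<le> M" for t x by (simp add: G1_def)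
  obtain E where E: "\<And>x. \<bar>G2 u x\<bar> \<le> E" using G2_bounded[OF goodD(1)[OF u]] by metis
  show ?thesis
  proof (rule goodI)
    show "t + u \<in> T" using t u by (intro T_add goodD)
    show "uniform_limit UNIV (\<lambda>n x. diff n (t + u) (\<lambda>u. G u x)) (\<lambda>_. t + u) sequentially"
      unfolding diff_G_add
      by (intro uniform_limit_add goodD(2)[OF u] uniform_limit_compose_right[OF goodD(2)[OF t]])
    show "\<bar>diff n (t + u) (\<lambda>u. G1 u x)\<bar> \<le> (C * M + D) / real (Suc n)" for n x
    proof -
      have "\<bar>diff n t (\<lambda>v. G1 v (G u x)) * G1 u x\<bar> \<le> C / real (Suc n) * M"
        unfolding abs_mult by (intro mult_mono' C absM) auto
      then show ?thesis using D[of n x] unfolding diff_G1_add by (simp add: add_divide_distrib)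
    qed
    have 1: "uniform_limit UNIV (\<lambda>n x. diff n t (\<lambda>v. G2 v (G u x)) * (G1 u x)\<^sup>2) (\<lambda>_. 0) sequentially"
      using power_mono[OF absM, of _ _ 2]
      by (intro uniform_limit_zero_mult_bounded[of _ _ "M\<^sup>2"]
          uniform_limit_compose_right[OF goodD(3)[OF t]]) auto
    have 2: "uniform_limit UNIV (\<lambda>n x. diff n t (\<lambda>v. G1 v (G u x)) * G2 u x) (\<lambda>_. 0) sequentially"
      by (rule uniform_limit_zero_mult_bounded[OF uniform_limit_inverse_Suc E]) (rule C)
    show "uniform_limit UNIV (\<lambda>n x. diff n (t + u) (\<lambda>u. G2 u x)) (\<lambda>_. 0) sequentially"
      unfolding diff_G2_add[OF goodD(1)[OF t] goodD(1)[OF u]]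
      using uniform_limit_add[OF uniform_limit_add[OF 1 2] goodD(3)[OF u]] by simp
  qed
qed

text \<open>\<open>G\<close> at an integer is a translation commuting with every \<open>G u\<close>,
  so the differences are constant for each \<open>n\<close>. The case 0 supplies the identity of the
  group.\<close>

lemma good_of_int: "of_int k \<in> good"
proof (rule goodI[OF of_int_in_T])
  have D: "diff n (of_int k) (\<lambda>u. G u x) = of_int k" for n x
    unfolding diff_def by (subst mean_const[of n "of_int k", symmetric], rule mean_cong)
      (simp add: add.commute[of _ "of_int k"] G_of_int flip: G_G)
  have D1: "diff n (of_int k) (\<lambda>u. G1 u x) = 0" for n x
    unfolding diff_def by (subst mean_const[of n 0, symmetric], rule mean_cong)
      (simp add: G1_def A_add A_of_int add.commute[of _ "of_int k"])
  have a0: "a (of_int k) y = 0" for y by (simp add: A_of_int[abs_def])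
  have D2: "diff n (of_int k) (\<lambda>u. G2 u x) = 0" for n x
    unfolding diff_def by (subst mean_const[of n 0, symmetric], rule mean_cong)
      (simp add: G2_def G1_def A_add A_of_int a_add of_int_in_T comb_T a0 add.commute[of _ "of_int k"])
  show "uniform_limit UNIV (\<lambda>n x. diff n (of_int k) (\<lambda>u. G u x)) (\<lambda>_. of_int k) sequentially"
    unfolding D by (rule uniform_limit_const)
  show "\<bar>diff n (of_int k) (\<lambda>u. G1 u x)\<bar> \<le> 0 / real (Suc n)" for n x unfolding D1 by simp
  show "uniform_limit UNIV (\<lambda>n x. diff n (of_int k) (\<lambda>u. G2 u x)) (\<lambda>_. 0) sequentially"
    unfolding D2 by (rule uniform_limit_const)
qed

lemma good_minus:
  assumes t: "t \<in> good"
  shows "- t \<in> good"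
proof -
  have T: "t \<in> T" "- t \<in> T" using goodD[OF t] T_minus by auto
  obtain C where C: "\<And>n x. \<bar>diff n t (\<lambda>u. G1 u x)\<bar> \<le> C / real (Suc n)" using goodD[OF t] by auto
  obtain M where M: "M > 0" "\<And>t x. G1 t x \<le> M" using G1_bounded by metis
  then have absM: "\<bar>G1 t x\<bar> \<le> M" for t x by (simp add: G1_def)
  obtain E where E: "\<And>x. \<bar>G2 (- t) x\<bar> \<le> E" using G2_bounded[OF T(2)] by metis
  \<comment> \<open>Inserting \<open>t + - t = 0\<close> into the addition formulas makes their left
    sides vanish, which solves them for the differences along \<open>- t\<close>.\<close>
  have D0: "diff n 0 X = 0" for n X by (simp add: diff_def mean_const)
  have D: "diff n (- t) (\<lambda>u. G u x) = - diff n t (\<lambda>u. G u (G (- t) x))" for n x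
    using diff_G_add[of n t "- t" x] by (simp add: D0)
  have D1: "diff n (- t) (\<lambda>u. G1 u x) = - (diff n t (\<lambda>u. G1 u (G (- t) x)) * G1 (- t) x)" for n x
    using diff_G1_add[of n t "- t" x] by (simp add: D0)
  have D2: "diff n (- t) (\<lambda>u. G2 u x) = - (diff n t (\<lambda>v. G2 v (G (- t) x)) * (G1 (- t) x)\<^sup>2
    + diff n t (\<lambda>v. G1 v (G (- t) x)) * G2 (- t) x)" for n x
    using diff_G2_add[OF T, of n x] by (simp add: D0)
  show ?thesis
  proof (rule goodI[OF T(2)])
    show "uniform_limit UNIV (\<lambda>n x. diff n (- t) (\<lambda>u. G u x)) (\<lambda>_. - t) sequentially"
      unfolding D by (intro uniform_limit_uminus uniform_limit_compose_right[OF goodD(2)[OF t]])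
    show "\<bar>diff n (- t) (\<lambda>u. G1 u x)\<bar> \<le> (C * M) / real (Suc n)" for n x
    proof -
      have "\<bar>diff n t (\<lambda>v. G1 v (G (- t) x)) * G1 (- t) x\<bar> \<le> C / real (Suc n) * M"
        unfolding abs_mult by (intro mult_mono' C absM) auto
      then show ?thesis unfolding D1 by simp
    qed
    have 1: "uniform_limit UNIV (\<lambda>n x. diff n t (\<lambda>v. G2 v (G (- t) x)) * (G1 (- t) x)\<^sup>2) (\<lambda>_. 0) sequentially"
      using power_mono[OF absM, of _ _ 2]
      by (intro uniform_limit_zero_mult_bounded[of _ _ "M\<^sup>2"]
          uniform_limit_compose_right[OF goodD(3)[OF t]]) auto
    have 2: "uniform_limit UNIV (\<lambda>n x. diff n t (\<lambda>v. G1 v (G (- t) x)) * G2 (- t) x) (\<lambda>_. 0) sequentially"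
      by (rule uniform_limit_zero_mult_bounded[OF uniform_limit_inverse_Suc E]) (rule C)
    show "uniform_limit UNIV (\<lambda>n x. diff n (- t) (\<lambda>u. G2 u x)) (\<lambda>_. 0) sequentially"
      unfolding D2 using uniform_limit_uminus[OF uniform_limit_add[OF 1 2]] by simp
  qed
qed

lemma is_lift_G_minus:
  assumes lift: "is_lift (G t) f" and "bij f"
  shows "is_lift (G (- t)) (inv_into UNIV f)"
proof -
  have "f (circle_proj (G (- t) x)) = circle_proj (G t (G (- t) x))" for x
    using lift by (simp only: is_lift_def)
  then have "f (circle_proj (G (- t) x)) = circle_proj x" for x
    by (simp add: G_def)
  then have "circle_proj (G (- t) x) = inv_into UNIV f (circle_proj x)" for x
    using \<open>bij f\<close> by (metis bij_is_inj inv_f_f)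
  moreover have "continuous_on UNIV (G (- t))"
    using DERIV_G by (meson DERIV_continuous_on has_field_derivative_at_within)
  ultimately show ?thesis by (simp add: is_lift_def)
qed

section \<open>The averaged maps and convergence of the conjugates\<close>

definition H :: "nat \<Rightarrow> real \<Rightarrow> real" where "H n x = mean n (\<lambda>u. G u x)"
definition H1 :: "nat \<Rightarrow> real \<Rightarrow> real" where "H1 n x = mean n (\<lambda>u. G1 u x)"
definition H2 :: "nat \<Rightarrow> real \<Rightarrow> real" where "H2 n x = mean n (\<lambda>u. G2 u x)"
definition J :: "nat \<Rightarrow> real \<Rightarrow> real" where "J n = inv_into UNIV (H n)"

lemma DERIV_H: "(H n has_real_derivative H1 n x) (at x)"
  unfolding H_def[abs_def] H1_def by (intro DERIV_mean DERIV_G)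

lemma DERIV_H1: "(H1 n has_real_derivative H2 n x) (at x)"
  unfolding H1_def[abs_def] H2_def by (intro DERIV_mean DERIV_G1 comb_T)

lemma cont_H2: "continuous_on UNIV (H2 n)"
  unfolding H2_def[abs_def] by (intro cont_mean cont_G2 comb_T)

lemma H_shift: "H n (x + 1) = H n x + 1"
  unfolding H_def G_shift mean_add mean_const ..

text \<open>A mean inherits the common lower bound of the \<open>G1 u\<close>. Its independence of
  \<open>n\<close> is what keeps the derivatives of the inverses \<open>J n\<close> uniformly
  bounded.\<close>

lemma H1_bounded: obtains m where "m > 0" "\<And>n x. H1 n x \<ge> m"
proof -
  obtain M where M: "M > 0" "\<And>t x. G1 t x \<ge> inverse M" using G1_bounded by metis
  have "H1 n x \<ge> inverse M" for n x
    using mean_mono[of n "\<lambda>_. inverse M" "\<lambda>u. G1 u x"] M by (simp add: H1_def mean_const)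
  then show thesis using that[of "inverse M"] M by simp
qed

lemma H1_pos: "H1 n x > 0" using H1_bounded by (metis less_le_trans)

lemma bij_H: "bij (H n)"
proof (rule bijI)
  have "strict_mono (H n)"
    by (rule strict_monoI) (metis DERIV_pos_imp_increasing DERIV_H H1_pos)
  then show "inj (H n)" by (rule strict_mono_imp_inj_on)
  show "surj (H n)"
    using DERIV_H by (intro surj_shift H_shift) (meson DERIV_continuous_on has_field_derivative_at_within)
qed

lemma H_J [simp]: "H n (J n x) = x" and J_H [simp]: "J n (H n x) = x"
  using bij_H[of n] by (simp_all add: J_def bij_is_surj surj_f_inv_f bij_is_inj)

lemma DERIV_J: "(J n has_real_derivative inverse (H1 n (J n x))) (at x)"
  by (rule DERIV_inverse_lift[OF DERIV_H H1_pos]) simp_all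

text \<open>\<open>G u (G t y) = G (u + t) y\<close> turns \<open>H n (G t y) - H n y\<close> into a
  difference of means; then take \<open>y = J n x\<close>.\<close>

lemma H_conj: "H n (G t (J n x)) = x + diff n t (\<lambda>u. G u (J n x))"
proof -
  have "diff n t (\<lambda>u. G u y) = H n (G t y) - H n y" for y
    by (simp add: diff_def H_def mean_diff G_G)
  then show ?thesis by simp
qed

lemma H2_sublinear: "uniform_limit UNIV (\<lambda>n x. H2 n x / real (Suc n)) (\<lambda>_. 0) sequentially"
proof (rule uniform_limitI)
  fix \<epsilon> :: real
  assume "\<epsilon> > 0"
  then have "\<epsilon> / 2 > 0" by simp
  from G2_box_sublinear[OF this]
  show "\<forall>\<^sub>F n in sequentially. \<forall>x\<in>UNIV. dist (H2 n x / real (Suc n)) 0 < \<epsilon>"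
  proof (eventually_elim, intro ballI)
    fix n x
    assume *: "\<forall>k x. (\<forall>r\<in>S. k r \<le> Suc n) \<longrightarrow> \<bar>G2 (comb k) x\<bar> \<le> \<epsilon> / 2 * real (Suc n)"
    have "\<bar>H2 n x\<bar> \<le> \<epsilon> / 2 * real (Suc n)"
      unfolding H2_def by (rule mean_abs_le) (use * in \<open>auto simp: box_def PiE_iff le_SucI\<close>)
    then have "\<bar>H2 n x\<bar> / real (Suc n) \<le> \<epsilon> / 2" by (simp add: pos_divide_le_eq del: of_nat_Suc)
    with \<open>\<epsilon> > 0\<close> show "dist (H2 n x / real (Suc n)) 0 < \<epsilon>"
      unfolding dist_real_def diff_0_right abs_divide abs_of_nat by linarith
  qed
qed


text \<open>The conjugate is the identity plus a difference evaluated at \<open>J n x\<close>. Its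
  second derivative has two terms: the \<open>G2\<close> difference with bounded factors, and the
  \<open>G1\<close> difference times the second derivative of \<open>J n\<close>. The latter is
  \<open>o(n)\<close> and meets a factor \<open>O(1/n)\<close>.\<close>

lemma good_conj_converges:
  assumes t: "t \<in> good"
    and lift: "\<And>n. is_lift (\<lambda>x. H n (G t (J n x))) (f n)"
  shows "Ck_converges 2 f (rotation (circle_proj t))"
proof -
  have T: "t \<in> T" by (rule goodD[OF t])
  obtain C where C: "\<And>n x. \<bar>diff n t (\<lambda>u. G1 u x)\<bar> \<le> C / real (Suc n)" using goodD[OF t] by auto
  obtain m where m: "m > 0" "\<And>n x. H1 n x \<ge> m" using H1_bounded by metis
  define J1 where "J1 n x = inverse (H1 n (J n x))" for n x
  define J2 where "J2 n x = - (J1 n x * (H2 n (J n x) * J1 n x) * J1 n x)" for n x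
  have DJ: "(J n has_real_derivative J1 n x) (at x)" for n x
    unfolding J1_def by (rule DERIV_J)
  have DJ1: "(J1 n has_real_derivative J2 n x) (at x)" for n x
    unfolding J1_def[abs_def] J2_def using H1_pos[of n "J n x"]
    by (intro DERIV_inverse' DERIV_chain2[OF DERIV_H1 DERIV_J]) auto
  have J1_le: "\<bar>J1 n x\<bar> \<le> inverse m" for n x
    using m(1) m(2)[of n "J n x"] unfolding J1_def by (simp add: le_imp_inverse_le)
  define F where "F n x = x + diff n t (\<lambda>u. G u (J n x))" for n x
  define F1 where "F1 n x = 1 + diff n t (\<lambda>u. G1 u (J n x)) * J1 n x" for n x
  define F2 where "F2 n x = diff n t (\<lambda>u. G2 u (J n x)) * (J1 n x * J1 n x)
      + J2 n x * diff n t (\<lambda>u. G1 u (J n x))" for n x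
  have DG: "((\<lambda>x. diff n t (\<lambda>u. G u x)) has_real_derivative diff n t (\<lambda>u. G1 u x)) (at x)" for n x
    unfolding diff_def by (intro DERIV_mean DERIV_diff DERIV_G)
  have DG1: "((\<lambda>x. diff n t (\<lambda>u. G1 u x)) has_real_derivative diff n t (\<lambda>u. G2 u x)) (at x)" for n x
    unfolding diff_def by (intro DERIV_mean DERIV_diff DERIV_G1 T_add comb_T T)
  have DF: "(F n has_real_derivative F1 n x) (at x)" for n x
    unfolding F_def[abs_def] F1_def by (intro DERIV_add DERIV_ident DERIV_chain2[OF DG DJ])
  have "(F1 n has_real_derivative 0 + (diff n t (\<lambda>u. G2 u (J n x)) * J1 n x * J1 n x
      + J2 n x * diff n t (\<lambda>u. G1 u (J n x)))) (at x)" for n x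
    unfolding F1_def[abs_def] by (intro DERIV_add DERIV_const DERIV_mult DERIV_chain2[OF DG1 DJ] DJ1)
  then have DF1: "(F1 n has_real_derivative F2 n x) (at x)" for n x
    by (simp add: F2_def mult.assoc)
  have cont: "continuous_on UNIV (\<lambda>x. X (J n x))" if "continuous_on UNIV X" for X :: "real \<Rightarrow> real" and n
    using continuous_on_compose2[OF that, of UNIV "J n"] DJ
    by (meson DERIV_continuous_on has_field_derivative_at_within subset_UNIV)
  have contG1: "continuous_on UNIV (\<lambda>x. diff n t (\<lambda>u. G1 u x))" for n
    unfolding diff_def by (intro cont_mean continuous_intros cont_G1 T_add comb_T T)
  have contG2: "continuous_on UNIV (\<lambda>x. diff n t (\<lambda>u. G2 u x))" for n
    unfolding diff_def by (intro cont_mean continuous_intros cont_G2 T_add comb_T T)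
  have contJ1: "continuous_on UNIV (J1 n)" for n
    using DJ1 by (meson DERIV_continuous_on has_field_derivative_at_within)
  have contF2: "continuous_on UNIV (F2 n)" for n
    unfolding F2_def[abs_def] J2_def
    by (intro continuous_intros contJ1 cont[OF contG1] cont[OF contG2] cont[OF cont_H2])
  have lim: "uniform_limit UNIV F (\<lambda>x. x + t) sequentially"
    unfolding F_def[abs_def]
    by (rule uniform_limit_add[OF uniform_limit_const uniform_limit_compose_right[OF goodD(2)[OF t]]])
  have G1_lim: "uniform_limit UNIV (\<lambda>n x. diff n t (\<lambda>u. G1 u (J n x))) (\<lambda>_. 0) sequentially"
    by (rule uniform_limit_inverse_Suc) (rule C)
  have lim1: "uniform_limit UNIV F1 (\<lambda>_. 1) sequentially"
    using uniform_limit_add[OF uniform_limit_const uniform_limit_zero_mult_bounded[OF G1_lim J1_le], of "\<lambda>_. 1"]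
    unfolding F1_def[abs_def] by simp
  have "\<bar>J1 n x * J1 n x\<bar> \<le> inverse m * inverse m" for n x
    unfolding abs_mult by (rule mult_mono'[OF J1_le J1_le]) simp_all
  from uniform_limit_zero_mult_bounded[OF uniform_limit_compose_right[OF goodD(3)[OF t]] this]
  have *: "uniform_limit UNIV (\<lambda>n x. diff n t (\<lambda>u. G2 u (J n x)) * (J1 n x * J1 n x)) (\<lambda>_. 0) sequentially" .
  have "uniform_limit UNIV (\<lambda>n x. J2 n x * diff n t (\<lambda>u. G1 u (J n x))) (\<lambda>_. 0) sequentially"
  proof -
    \<comment> \<open>A factor \<open>Suc n\<close> is moved from \<open>H2\<close> to the
      \<open>G1\<close> difference: the product becomes \<open>H2 n (J n x) / real (Suc n)\<close>,
      which tends to 0, times the bounded \<open>R\<close>.\<close>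
    define R where "R n x = - (J1 n x * J1 n x * J1 n x * (diff n t (\<lambda>u. G1 u (J n x)) * real (Suc n)))" for n x
    have "\<bar>R n x\<bar> \<le> inverse m * inverse m * inverse m * C" for n x
    proof -
      have "\<bar>diff n t (\<lambda>u. G1 u (J n x)) * real (Suc n)\<bar> \<le> C"
        using C[of n "J n x"] by (simp add: abs_mult pos_le_divide_eq del: of_nat_Suc)
      then show ?thesis
        unfolding R_def abs_minus_cancel abs_mult using J1_le m(1) by (intro mult_mono) auto
    qed
    from uniform_limit_zero_mult_bounded[OF uniform_limit_compose_right[OF H2_sublinear] this]
    have "uniform_limit UNIV (\<lambda>n x. H2 n (J n x) / real (Suc n) * R n x) (\<lambda>_. 0) sequentially" .
    moreover have "H2 n (J n x) / real (Suc n) * R n x = J2 n x * diff n t (\<lambda>u. G1 u (J n x))" for n x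
      by (simp add: R_def J2_def del: of_nat_Suc)
    ultimately show ?thesis by simp
  qed
  from uniform_limit_add[OF * this] have lim2: "uniform_limit UNIV F2 (\<lambda>_. 0) sequentially"
    by (simp add: F2_def[abs_def])
  have rot1: "((\<lambda>x. x + t) has_real_derivative 1) (at x)"
    and rot2: "((\<lambda>_::real. 1::real) has_real_derivative 0) (at x)" for x
    by (auto intro!: derivative_eq_intros)
  show ?thesis
    unfolding Ck_converges_def
  proof (intro exI conjI allI impI)
    show "is_lift (F n) (f n)" for n using lift[of n] by (simp add: F_def[abs_def] H_conj)
    show "Ck_real 2 (F n)" for n by (rule Ck_real_2I[OF DF DF1 contF2])
    show "is_lift (\<lambda>x. x + t) (rotation (circle_proj t))" by (rule is_lift_rotation)
    show "Ck_real 2 (\<lambda>x. x + t)" by (rule Ck_real_2I[OF rot1 rot2]) simp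
    fix j :: nat
    assume "j \<le> 2"
    then consider "j = 0" | "j = 1" | "j = 2" by linarith
    then show "uniform_limit UNIV (\<lambda>n. (deriv ^^ j) (F n)) ((deriv ^^ j) (\<lambda>x. x + t)) sequentially"
    proof cases
      case 1
      then show ?thesis using lim by simp
    next
      case 2
      show ?thesis unfolding 2 deriv_funpow_1[OF DF DF1] deriv_funpow_1[OF rot1 rot2] by (rule lim1)
    next
      case 3
      show ?thesis unfolding 3 deriv_funpow_2[OF DF DF1] deriv_funpow_2[OF rot1 rot2] by (rule lim2)
    qed
  qed
qed

end

section \<open>The group of circle bijections and the passage back to the circle\<close>

lemma mult_BijGroup_UNIV:
  assumes "bij f" "bij g"
  shows "f \<otimes>\<^bsub>BijGroup UNIV\<^esub> g = f \<circ> g"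
  using assms by (auto simp: BijGroup_def Bij_def compose_def)

lemma inv_BijGroup_UNIV:
  assumes "bij f"
  shows "inv\<^bsub>BijGroup UNIV\<^esub> f = inv_into UNIV f"
proof (rule group.inv_equality[OF group_BijGroup])
  show "inv_into UNIV f \<otimes>\<^bsub>BijGroup UNIV\<^esub> f = \<one>\<^bsub>BijGroup UNIV\<^esub>"
    using assms by (subst mult_BijGroup_UNIV)
      (auto simp: bij_imp_bij_inv BijGroup_def bij_is_inj id_def restrict_def)
  show "f \<in> carrier (BijGroup UNIV)" "inv_into UNIV f \<in> carrier (BijGroup UNIV)"
    using assms by (auto simp: BijGroup_def Bij_def bij_imp_bij_inv)
qed

theorem theorem4:
  fixes \<Gamma> :: "(circle \<Rightarrow> circle) set"
  assumes "subgroup \<Gamma> (BijGroup UNIV)"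
    and "comm_group ((BijGroup UNIV)\<lparr>carrier := \<Gamma>\<rparr>)"
    and "\<exists>S. finite S \<and> \<Gamma> = generate (BijGroup UNIV) S"
    and "\<forall>f\<in>\<Gamma>. circle_diffeo 2 f"
    and "\<exists>\<phi>. circle_diffeo 1 \<phi> \<and> (\<forall>f\<in>\<Gamma>. \<exists>\<rho>. inv_into UNIV \<phi> \<circ> f \<circ> \<phi> = rotation \<rho>)"
  shows "\<exists>h :: nat \<Rightarrow> circle \<Rightarrow> circle. (\<forall>n. circle_diffeo 2 (h n)) \<and>
    (\<forall>f\<in>\<Gamma>. \<exists>\<rho>. Ck_converges 2 (\<lambda>n. h n \<circ> f \<circ> inv_into UNIV (h n)) (rotation \<rho>))"
proof -
  obtain \<phi> where \<phi>: "circle_diffeo 1 \<phi>"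
    and rot: "\<And>f. f \<in> \<Gamma> \<Longrightarrow> \<exists>\<rho>. inv_into UNIV \<phi> \<circ> f \<circ> \<phi> = rotation \<rho>"
    using assms(5) by blast
  obtain \<Sigma> where \<Sigma>: "finite \<Sigma>" "\<Gamma> = generate (BijGroup UNIV) \<Sigma>" using assms(3) by blast
  obtain \<Phi> \<Psi> where lift\<Phi>: "is_lift \<Phi> \<phi>" and lift\<Psi>: "is_lift \<Psi> (inv_into UNIV \<phi>)"
    and \<Phi>: "\<And>x. (\<Phi> has_real_derivative deriv \<Phi> x) (at x)" "continuous_on UNIV (deriv \<Phi>)"
    "\<And>x. deriv \<Phi> x > 0" "\<And>x. \<Phi> (x + 1) = \<Phi> x + 1"
    "\<And>x. \<Phi> (\<Psi> x) = x" "\<And>x. \<Psi> (\<Phi> x) = x"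
    using circle_diffeo_1_lifts[OF \<phi>] by metis
  interpret C1_conjugacy \<Phi> "deriv \<Phi>" \<Psi> by unfold_locales (rule \<Phi>)+
  \<comment> \<open>Undoing the conjugation writes \<open>f\<close> through \<open>\<phi>\<close>
    and a rotation, so some \<open>G t\<close> lifts it. This lift differs by an integer from a
    \<open>C^2\<close> lift of \<open>f\<close>, which puts \<open>t\<close> into
    \<open>T\<close>.\<close>
  have ex_lift: "\<exists>t\<in>T. is_lift (G t) f" if f: "f \<in> \<Gamma>" for f
  proof -
    have bij: "bij \<phi>" using \<phi> by (simp add: circle_diffeo_def)
    obtain t where t: "inv_into UNIV \<phi> \<circ> f \<circ> \<phi> = rotation (circle_proj t)"
      using rot[OF f] by (metis circle_proj_surj)
    have "f x = (\<phi> \<circ> (rotation (circle_proj t) \<circ> inv_into UNIV \<phi>)) x" for x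
      unfolding t[symmetric] using bij by (simp add: bij_is_surj surj_f_inv_f)
    then have f_eq: "f = \<phi> \<circ> (rotation (circle_proj t) \<circ> inv_into UNIV \<phi>)" by blast
    have lift: "is_lift (G t) f"
      unfolding f_eq using is_lift_comp[OF lift\<Phi> is_lift_comp[OF is_lift_rotation lift\<Psi>, of t]]
      by (simp add: comp_def G_def[abs_def])
    obtain F where F: "is_lift F f" "Ck_real 2 F"
      using assms(4) f by (auto simp: circle_diffeo_def Ck_circle_def)
    obtain k :: int where k: "\<And>x. G t x = F x + k" using is_lift_unique[OF lift F(1)] by blast
    then have G_eq: "G t = (\<lambda>x. F x + k)" by blast
    have "Ck_real 2 (G t)"
    proof (rule Ck_real_2I)
      show "(G t has_real_derivative deriv F x) (at x)" for x
        unfolding G_eq using DERIV_add[OF Ck_real_2D(1)[OF F(2)] DERIV_const] by simp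
    qed (rule Ck_real_2D[OF F(2)])+
    with lift show ?thesis using in_T_if_C2 by blast
  qed
  have "\<Sigma> \<subseteq> \<Gamma>" unfolding \<Sigma>(2) by (blast intro: generate.incl)
  \<comment> \<open>One translation number is fixed for each generator; these numbers span the
    boxes.\<close>
  then obtain r where r: "\<And>f. f \<in> \<Sigma> \<Longrightarrow> r f \<in> T" "\<And>f. f \<in> \<Sigma> \<Longrightarrow> is_lift (G (r f)) f"
    using ex_lift by (metis subsetD)
  interpret C1_conjugacy_box \<Phi> "deriv \<Phi>" \<Psi> "r ` \<Sigma>"
    by unfold_locales (use \<Sigma>(1) r(1) in auto)
  \<comment> \<open>Induction over the generated group: composition adds translation numbers and
    inversion negates them, and \<open>good\<close> is closed under both.\<close>
  have good_lift: "\<exists>t\<in>good. is_lift (G t) f" if "f \<in> \<Gamma>" for f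
    using that unfolding \<Sigma>(2)
  proof (induction rule: generate.induct)
    case one
    have "is_lift (G 0) id" using is_lift_id by (simp add: G_def[abs_def])
    then show ?case using good_of_int[of 0] by (auto simp: BijGroup_def id_def restrict_def)
  next
    case (incl h)
    then show ?case using r(2) good_generator by blast
  next
    case (inv f)
    with \<open>\<Sigma> \<subseteq> \<Gamma>\<close> have "bij f" using assms(4) by (auto simp: circle_diffeo_def)
    moreover have "is_lift (G (r f)) f" "r f \<in> good" using inv r(2) good_generator by blast+
    ultimately show ?case
      using good_minus is_lift_G_minus by (metis inv_BijGroup_UNIV)
  next
    case (eng f g)
    then have "bij f" "bij g" using assms(4) by (auto simp: circle_diffeo_def \<Sigma>(2))
    moreover obtain t u where "t \<in> good" "u \<in> good" "is_lift (G t) f" "is_lift (G u) g"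
      using eng by blast
    moreover from this have "is_lift (G (t + u)) (f \<circ> g)"
      using is_lift_comp[of "G t" f "G u" g] by (simp add: comp_def G_G)
    ultimately show ?case using good_add by (metis mult_BijGroup_UNIV)
  qed
  define h where "h n = circle_map (H n)" for n
  note h = circle_diffeo_2_map[OF DERIV_H DERIV_H1 cont_H2 H1_pos H_shift H_J J_H, folded h_def]
  show ?thesis
  proof (intro exI[of _ h] conjI allI ballI)
    show "circle_diffeo 2 (h n)" for n by (rule h)
    fix f assume "f \<in> \<Gamma>"
    then obtain t where t: "t \<in> good" "is_lift (G t) f" using good_lift by blast
    \<comment> \<open>Lifts compose, so the conjugate on the circle is lifted by the conjugate on
      the line.\<close>
    have "is_lift (\<lambda>x. H n (G t (J n x))) (h n \<circ> f \<circ> inv_into UNIV (h n))" for n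
      using is_lift_comp[OF is_lift_comp[OF h(3) t(2)] h(4)] by (simp add: h(2) comp_def)
    with t(1) show "\<exists>\<rho>. Ck_converges 2 (\<lambda>n. h n \<circ> f \<circ> inv_into UNIV (h n)) (rotation \<rho>)"
      by (blast intro: good_conj_converges)
  qed
qed

end
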